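(* With $A=\{p_1,\dots,p_a\}$, $B$, and $t_\eta$ ($\eta\in B$) as defined in the context, the rank of every primitive new regular $\mathbb{Z}$-lattice is at most $\sum_{\eta\in B} t_\eta$. In particular, there is an absolute constant bounding the rank of all new regular $\mathbb{Z}$-lattices.
   Context: A $\mathbb{Z}$-lattice is a free $\mathbb{Z}$-module of finite rank with a positive definite symmetric bilinear form $B$ with values in $\mathbb{Z}$; $Q(\mathbf x)=B(\mathbf x,\mathbf x)$ and $Q(L)=\{Q(\mathbf x):\mathbf x\in L\}$. $L$ is primitive if the ideal generated by all $B(\mathbf x,\mathbf y)$ is $\mathbb{Z}$. $L$ is regular if it represents every integer represented by $L_p=L\otimes\mathbb{Z}_p$ for all primes $p$. A regular $L$ is new if there is no proper sublattice $M\subsetneq L$ with $Q(M)=Q(L)$. Let $SC_2=\{1,3,5,7,2,6,10,14\}$, and for odd $p$, $SC_p=\{1,\Delta_p,p,p\Delta_p\}$ with $\Delta_p$ a fixed non-square unit of $\mathbb{Z}_p$. For a $\mathbb{Z}_p$-lattice $M$ of rank $\ge4$ and $s\in SC_p$, let $u\ge0$ be least with $sp^{2u}\in Q(M)$; $\nu_{p,s}(M)=\mathrm{ord}_p(sp^{2u})$, $\nu_p(M)=\max_s\nu_{p,s}(M)$, $\nu'_p(M)=\max\{\nu_{p,s}(M):s\in SC_p\setminus\{s_0\}\}$ for any $s_0$ attaining $\nu_p(M)$; for a $\mathbb{Z}$-lattice $L$, $\nu_p(L)=\nu_p(L_p)$, $\nu'_p(L)=\nu'_p(L_p)$. Let $A$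 be the set of primes $p$ for which some primitive regular $\mathbb{Z}$-lattice $L$ of rank $\ge4$ has $\nu_p(L)>1$; it is known that $A$ is finite, say $A=\{p_1,\dots,p_a\}$. For each $p\in A$ fix a positive integer $\nu'_p$ such that $\nu'_p(L)\le\nu'_p$ for every primitive regular $\mathbb{Z}$-lattice $L$ of rank $\ge4$ (such exists). Put $B_2=\{2^{c}b: 0\le c\le \nu'_2+3,\ b\in\{1,3,5,7\}\}$ (if $2\in A$) and $B_p=\{p^{c}b: 0\le c\le\nu'_p+3,\ b\in\{1,\Delta_p\}\}$ for odd $p\in A$, and $B=\prod_{i=1}^a B_{p_i}\subset\prod_{i}\mathbb{Z}_{p_i}$. For $\eta=(\eta_{p_1},\dots,\eta_{p_a})$ with nonzero entries, let $S_\eta=\{n\in\mathbb{N}: \eta_{p_i}^{-1}n\in(\mathbb{Z}_{p_i}^\times)^2 \text{ for } i=1,\dots,a\}$. For a set $S$ of positive integers, a finite $S$-universality criterion set is a finite subset $T\subseteq S$ such that every $\mathbb{Z}$-lattice representing all elements of $T$ represents all elements of $S$; such sets exist. For each $\eta\in B$ let $T_\eta$ be a finite $S_\eta$-universality criterion set and $t_\eta=|T_\eta|$. *)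

theory Defs
  imports "HOL-Number_Theory.Number_Theory" "HOL-Library.FuncSet"
begin

text \<open>A Z-lattice of rank n is modelled (up to isometry) by Z^n with Gram matrix G:
  vectors are functions nat => int supported on {0..<n}.\<close>

definition vecs :: "nat \<Rightarrow> (nat \<Rightarrow> int) set" where
  "vecs n = {x. \<forall>i\<ge>n. x i = 0}"

definition bform :: "nat \<Rightarrow> (nat \<Rightarrow> nat \<Rightarrow> int) \<Rightarrow> (nat \<Rightarrow> int) \<Rightarrow> (nat \<Rightarrow> int) \<Rightarrow> int" where
  "bform n G x y = (\<Sum>i<n. \<Sum>j<n. G i j * x i * y j)"

definition qform :: "nat \<Rightarrow> (nat \<Rightarrow> nat \<Rightarrow> int) \<Rightarrow> (nat \<Rightarrow> int) \<Rightarrow> int" where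
  "qform n G x = bform n G x x"

definition zlattice :: "nat \<Rightarrow> (nat \<Rightarrow> nat \<Rightarrow> int) \<Rightarrow> bool" where
  "zlattice n G \<longleftrightarrow> (\<forall>i<n. \<forall>j<n. G i j = G j i) \<and>
     (\<forall>x\<in>vecs n. x \<noteq> (\<lambda>_. 0) \<longrightarrow> qform n G x > 0)"

definition qvals :: "nat \<Rightarrow> (nat \<Rightarrow> nat \<Rightarrow> int) \<Rightarrow> int set" where
  "qvals n G = qform n G ` vecs n"

definition primitive :: "nat \<Rightarrow> (nat \<Rightarrow> nat \<Rightarrow> int) \<Rightarrow> bool" where
  "primitive n G \<longleftrightarrow> (\<forall>d::int. (\<forall>x\<in>vecs n. \<forall>y\<in>vecs n. d dvd bform n G x y) \<longrightarrow> is_unit d)"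

text \<open>The integer a is represented by L_p = L tensor Z_p.  Since Z^n is dense in Z_p^n
  and Z_p^n is compact, this holds iff Q(x) = a (mod p^k) is solvable in Z^n for every k.\<close>
definition loc_rep :: "nat \<Rightarrow> nat \<Rightarrow> (nat \<Rightarrow> nat \<Rightarrow> int) \<Rightarrow> int \<Rightarrow> bool" where
  "loc_rep p n G a \<longleftrightarrow> (\<forall>k::nat. \<exists>x\<in>vecs n. [qform n G x = a] (mod (int p ^ k)))"

definition regular :: "nat \<Rightarrow> (nat \<Rightarrow> nat \<Rightarrow> int) \<Rightarrow> bool" where
  "regular n G \<longleftrightarrow> (\<forall>a::int. a > 0 \<longrightarrow> (\<forall>p. prime p \<longrightarrow> loc_rep p n G a) \<longrightarrow> a \<in> qvals n G)"

definition sublattice :: "nat \<Rightarrow> (nat \<Rightarrow> int) set \<Rightarrow> bool" where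
  "sublattice n M \<longleftrightarrow> M \<subseteq> vecs n \<and> (\<lambda>_. 0) \<in> M \<and>
     (\<forall>x\<in>M. \<forall>y\<in>M. (\<lambda>i. x i + y i) \<in> M) \<and> (\<forall>x\<in>M. \<forall>c::int. (\<lambda>i. c * x i) \<in> M)"

definition new_regular :: "nat \<Rightarrow> (nat \<Rightarrow> nat \<Rightarrow> int) \<Rightarrow> bool" where
  "new_regular n G \<longleftrightarrow> regular n G \<and>
     \<not> (\<exists>M. sublattice n M \<and> M \<noteq> vecs n \<and> qform n G ` M = qvals n G)"

text \<open>Fixed non-square unit Delta_p (odd p): least positive quadratic non-residue mod p.\<close>
definition Delta :: "nat \<Rightarrow> int" where
  "Delta p = int (LEAST d::nat. d > 0 \<and> \<not> (\<exists>y::int. [y^2 = int d] (mod int p)))"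

definition SC :: "nat \<Rightarrow> int set" where
  "SC p = (if p = 2 then {1,3,5,7,2,6,10,14} else {1, Delta p, int p, int p * Delta p})"

definition nu_s :: "nat \<Rightarrow> nat \<Rightarrow> (nat \<Rightarrow> nat \<Rightarrow> int) \<Rightarrow> int \<Rightarrow> nat" where
  "nu_s p n G s = multiplicity (int p)
     (s * int p ^ (2 * (LEAST u::nat. loc_rep p n G (s * int p ^ (2 * u)))))"

definition nu :: "nat \<Rightarrow> nat \<Rightarrow> (nat \<Rightarrow> nat \<Rightarrow> int) \<Rightarrow> nat" where
  "nu p n G = Max (nu_s p n G ` SC p)"

definition nu' :: "nat \<Rightarrow> nat \<Rightarrow> (nat \<Rightarrow> nat \<Rightarrow> int) \<Rightarrow> nat" where
  "nu' p n G = (let s0 = (SOME s. s \<in> SC p \<and> nu_s p n G s = nu p n G)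
                in Max (nu_s p n G ` (SC p - {s0})))"

definition Aset :: "nat set" where
  "Aset = {p. prime p \<and> (\<exists>n G. zlattice n G \<and> n \<ge> 4 \<and> primitive n G \<and> regular n G \<and> nu p n G > 1)}"

definition Bp :: "(nat \<Rightarrow> nat) \<Rightarrow> nat \<Rightarrow> int set" where
  "Bp nub p = {int p ^ c * b | c b. c \<le> nub p + 3 \<and>
      b \<in> (if p = 2 then {1,3,5,7} else {1, Delta p})}"

definition Bset :: "(nat \<Rightarrow> nat) \<Rightarrow> (nat \<Rightarrow> int) set" where
  "Bset nub = PiE Aset (Bp nub)"

text \<open>e^{-1} n is a square of a p-adic unit.  As e*(Z_p^x)^2 is compact, this holds iff for
  every k there is an integer x prime to p with e x^2 = n (mod p^k).\<close>
definition unit_sq_class :: "nat \<Rightarrow> int \<Rightarrow> int \<Rightarrow> bool" where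
  "unit_sq_class p e m \<longleftrightarrow> (\<forall>k::nat. \<exists>x::int. coprime x (int p) \<and> [e * x^2 = m] (mod (int p ^ k)))"

definition S_eta :: "(nat \<Rightarrow> int) \<Rightarrow> int set" where
  "S_eta eta = {m. m > 0 \<and> (\<forall>p\<in>Aset. unit_sq_class p (eta p) m)}"

definition univ_criterion :: "int set \<Rightarrow> int set \<Rightarrow> bool" where
  "univ_criterion S T \<longleftrightarrow> finite T \<and> T \<subseteq> S \<and>
     (\<forall>n G. zlattice n G \<longrightarrow> T \<subseteq> qvals n G \<longrightarrow> S \<subseteq> qvals n G)"

end

theory Submission
  imports Defs
begin

text \<open>Let \<open>L\<close> be primitive and regular of rank at least 4. Over \<open>\<int>\<^sub>p\<close>, \<open>p \<notin> A\<close>, it represents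
  everything. For \<open>\<eta> \<in> B\<close> let \<open>k\<^sub>p\<close> be least such that \<open>\<eta>\<^sub>p p\<^bsup>2k\<^esup>\<close> with \<open>k = k\<^sub>p\<close> is represented
  by \<open>L\<close> over \<open>\<int>\<^sub>p\<close>, and let \<open>D\<close> be the product of the powers of \<open>p \<in> A\<close> with exponent \<open>k\<^sub>p\<close>.
  By regularity there are vectors \<open>x\<^sub>t \<in> L\<close>, \<open>t \<in> T\<^sub>\<eta>\<close>, with \<open>Q(x\<^sub>t) = D\<^sup>2 t\<close>. All inner products of
  these vectors are divisible by \<open>D\<^sup>2\<close> if \<open>p\<^sup>2\<close> divides \<open>\<eta>\<^sub>p\<close> whenever \<open>k\<^sub>p > 0\<close>, for otherwise Hensel's
  lemma on the binary lattice spanned by two of them contradicts the minimality of \<open>k\<^sub>p\<close>. So their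
  span, scaled by \<open>1/D\<^sup>2\<close>, is an integral lattice, which represents \<open>S\<^sub>\<eta>\<close> since \<open>T\<^sub>\<eta>\<close> is a criterion set.
  Every value of \<open>L\<close> is, up to square factors \<open>p\<^sup>2\<close> that can be split off within \<open>L\<close>, in one of the
  sets \<open>D\<^sup>2 S\<^sub>\<eta>\<close>. Hence the span of all these vectors has the same values as \<open>L\<close>, and equals \<open>L\<close>
  if \<open>L\<close> is new.\<close>

lemma odd_prime_if_not_2: "prime (p::nat) \<Longrightarrow> p \<noteq> 2 \<Longrightarrow> odd p"
  by (metis le_neq_implies_less prime_ge_2_nat prime_odd_nat)

subsection \<open>Square classes of p-adic integers\<close>

text \<open>Newton iteration, one power of \<open>p\<close> at a time. Precision
  \<open>2 * j + 1\<close> makes every correction divisible by \<open>p^(j+1)\<close>, so the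
  derivative keeps its exact order \<open>j\<close>.\<close>

lemma hensel_quadratic:
  fixes a b c x0 :: int
  assumes p: "prime p"
    and root: "[a * x0\<^sup>2 + b * x0 + c = 0] (mod int p ^ (2 * j + 1))"
    and deriv: "2 * a * x0 + b = int p ^ j * w" "coprime w (int p)"
  shows "\<exists>x. [x = x0] (mod int p ^ Suc j) \<and> [a * x\<^sup>2 + b * x + c = 0] (mod int p ^ k)"
proof -
  have "\<exists>x. [x = x0] (mod int p ^ Suc j) \<and> [a * x\<^sup>2 + b * x + c = 0] (mod int p ^ (2 * j + 1 + i))" for i
  proof (induction i)
    case 0
    then show ?case using root by (intro exI[of _ x0]) auto
  next
    case (Suc i)
    define m where "m = 2 * j + 1 + i"
    obtain x r where x: "[x = x0] (mod int p ^ Suc j)" and r: "a * x\<^sup>2 + b * x + c = int p ^ m * r"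
      using Suc unfolding cong_0_iff m_def dvd_def by auto
    obtain y where y: "x - x0 = int p ^ Suc j * y"
      using x by (auto simp: cong_iff_dvd_diff)
    define v where "v = w + 2 * a * int p * y"
    have dv: "2 * a * x + b = int p ^ j * v"
    proof -
      have "2 * a * x + b = (2 * a * x0 + b) + 2 * a * (x - x0)" by (simp add: algebra_simps)
      also have "\<dots> = int p ^ j * v" unfolding deriv(1) y v_def by (simp add: algebra_simps)
      finally show ?thesis .
    qed
    have "coprime v (int p)"
    proof -
      have "[w = v] (mod int p)"
        unfolding v_def by (simp add: cong_iff_dvd_diff)
      then show ?thesis using deriv(2) cong_imp_coprime by blast
    qed
    then obtain z where z: "[v * z = 1] (mod int p)"
      using cong_solve_coprime_int by blast
    \<comment> \<open>Changing \<open>x\<close> by \<open>t * p^(m-j)\<close> changes the value by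
      \<open>p^m * t * v\<close> to first order, so \<open>t\<close> has to be
      \<open>- r / v\<close> modulo \<open>p\<close>.\<close>
    define t where "t = - r * z"
    have rt: "int p dvd r + t * v"
    proof -
      have "r + t * v = - r * (v * z - 1)" unfolding t_def by (simp add: algebra_simps)
      moreover have "int p dvd v * z - 1" using z by (simp add: cong_iff_dvd_diff)
      ultimately show ?thesis by (metis dvd_mult)
    qed
    \<comment> \<open>By \<open>2 * q = Suc m + i\<close> the second-order term vanishes modulo
      \<open>p^(m+1)\<close>; by \<open>q = Suc j + i\<close> the class of \<open>x\<close> modulo
      \<open>p^(j+1)\<close> is kept.\<close>
    define q where "q = m - j"
    have mq: "m = q + j" and qq: "q = Suc j + i" and qm: "2 * q = Suc m + i"
      unfolding q_def m_def by auto
    define x' where "x' = x + t * int p ^ q"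
    have "a * (x + t * s)\<^sup>2 + b * (x + t * s) + c
        = (a * x\<^sup>2 + b * x + c) + t * s * (2 * a * x + b) + a * t\<^sup>2 * (s * s)" for s
      by (simp add: power2_eq_square algebra_simps)
    then have "a * x'\<^sup>2 + b * x' + c
        = (a * x\<^sup>2 + b * x + c) + t * int p ^ q * (2 * a * x + b) + a * t\<^sup>2 * int p ^ (2 * q)"
      unfolding x'_def mult_2 power_add by blast
    also have "\<dots> = int p ^ m * (r + t * v) + a * t\<^sup>2 * int p ^ (2 * q)"
      unfolding r dv mq by (simp add: algebra_simps power_add)
    finally have e: "a * x'\<^sup>2 + b * x' + c = int p ^ m * (r + t * v) + a * t\<^sup>2 * int p ^ (2 * q)" .
    have "int p ^ Suc m dvd int p ^ m * (r + t * v)"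
      using rt by (simp add: mult.commute mult_dvd_mono)
    moreover have "int p ^ Suc m dvd a * t\<^sup>2 * int p ^ (2 * q)"
      unfolding qm by (simp add: power_add)
    ultimately have "[a * x'\<^sup>2 + b * x' + c = 0] (mod int p ^ Suc m)"
      unfolding e cong_0_iff by (rule dvd_add)
    moreover have "[x' = x0] (mod int p ^ Suc j)"
    proof -
      have "x' - x0 = int p ^ Suc j * (y + t * int p ^ i)"
        using y unfolding x'_def qq by (simp add: algebra_simps power_add)
      then show ?thesis by (simp add: cong_iff_dvd_diff)
    qed
    ultimately show ?case unfolding m_def by auto
  qed
  from this[of k] show ?thesis
    using cong_dvd_modulus[OF _ le_imp_power_dvd[of k "2 * j + 1 + k"]] by (meson le_add2)
qed

text \<open>For exponent 0 the congruence is empty; with positive exponents, whatever is invertible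
  modulo the prime power is prime to \<open>p\<close>.\<close>

lemma unit_sq_classI:
  assumes "\<And>k. \<exists>x. coprime x (int p) \<and> [e * x\<^sup>2 = m] (mod int p ^ Suc k)"
  shows "unit_sq_class p e m"
  unfolding unit_sq_class_def
proof
  fix k
  obtain x where "coprime x (int p)" "[e * x\<^sup>2 = m] (mod int p ^ Suc k)" using assms by blast
  then show "\<exists>x. coprime x (int p) \<and> [e * x\<^sup>2 = m] (mod int p ^ k)"
    using cong_dvd_modulus[OF _ le_imp_power_dvd[of k "Suc k"]] by (meson le_SucI order_refl)
qed

lemma unit_sq_class_sym:
  assumes "unit_sq_class p e m"
  shows "unit_sq_class p m e"
proof (rule unit_sq_classI)
  fix k
  obtain x where x: "coprime x (int p)" "[e * x\<^sup>2 = m] (mod int p ^ Suc k)"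
    using assms unfolding unit_sq_class_def by blast
  then obtain y where y: "[x * y = 1] (mod int p ^ Suc k)"
    using cong_solve_coprime_int[of x "int p ^ Suc k"] by auto
  then have "coprime (x * y) (int p ^ Suc k)"
    by (metis cong_imp_coprime cong_sym coprime_1_left)
  then have "coprime y (int p)" by simp
  moreover have "[m * y\<^sup>2 = e] (mod int p ^ Suc k)"
  proof -
    have "[m * y\<^sup>2 = e * x\<^sup>2 * y\<^sup>2] (mod int p ^ Suc k)"
      using x(2) by (intro cong_mult cong_refl) (simp add: cong_sym)
    also have "e * x\<^sup>2 * y\<^sup>2 = e * (x * y)\<^sup>2" by (simp add: power_mult_distrib)
    also have "[e * (x * y)\<^sup>2 = e * 1\<^sup>2] (mod int p ^ Suc k)"
      using y by (intro cong_mult cong_refl cong_pow)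
    finally show ?thesis by simp
  qed
  ultimately show "\<exists>x. coprime x (int p) \<and> [m * x\<^sup>2 = e] (mod int p ^ Suc k)" by blast
qed

lemma unit_sq_class_trans:
  assumes "unit_sq_class p e m" "unit_sq_class p m r"
  shows "unit_sq_class p e r"
  unfolding unit_sq_class_def
proof
  fix k
  obtain x where x: "coprime x (int p)" "[e * x\<^sup>2 = m] (mod int p ^ k)"
    using assms(1) unfolding unit_sq_class_def by blast
  obtain y where y: "coprime y (int p)" "[m * y\<^sup>2 = r] (mod int p ^ k)"
    using assms(2) unfolding unit_sq_class_def by blast
  have "[e * x\<^sup>2 * y\<^sup>2 = m * y\<^sup>2] (mod int p ^ k)" using x by (intro cong_mult cong_refl)
  also note y(2)
  finally have "[e * (x * y)\<^sup>2 = r] (mod int p ^ k)" by (simp add: power_mult_distrib mult_ac)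
  with x y show "\<exists>x. coprime x (int p) \<and> [e * x\<^sup>2 = r] (mod int p ^ k)"
    by (intro exI[of _ "x * y"]) auto
qed

lemma unit_sq_class_mult:
  assumes "unit_sq_class p e m"
  shows "unit_sq_class p (r * e) (r * m)"
  unfolding unit_sq_class_def
proof
  fix k
  obtain x where x: "coprime x (int p)" "[e * x\<^sup>2 = m] (mod int p ^ k)"
    using assms(1) unfolding unit_sq_class_def by blast
  from cong_mult[OF cong_refl this(2), of r] x(1)
  show "\<exists>x. coprime x (int p) \<and> [r * e * x\<^sup>2 = r * m] (mod int p ^ k)" by (auto simp: mult_ac)
qed

lemma unit_sq_class_cancel:
  assumes "prime p" "unit_sq_class p (int p ^ c * e) (int p ^ c * m)"
  shows "unit_sq_class p e m"
  unfolding unit_sq_class_def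
proof
  fix k
  have p0: "int p > 0" using assms(1) by (simp add: prime_gt_0_nat)
  \<comment> \<open>Division by \<open>p^c\<close> loses \<open>c\<close> digits, hence the
    precision \<open>c + k\<close>.\<close>
  obtain x where x: "coprime x (int p)" "[int p ^ c * e * x\<^sup>2 = int p ^ c * m] (mod int p ^ (c + k))"
    using assms(2) unfolding unit_sq_class_def by blast
  have "int p ^ c * int p ^ k dvd int p ^ c * (e * x\<^sup>2 - m)"
    using x(2) unfolding cong_iff_dvd_diff by (simp add: algebra_simps power_add)
  then have "int p ^ k dvd e * x\<^sup>2 - m"
    using p0 by simp
  then show "\<exists>x. coprime x (int p) \<and> [e * x\<^sup>2 = m] (mod int p ^ k)"
    using x(1) cong_iff_dvd_diff by blast
qed

lemma unit_sq_class_square_mult: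
  assumes "coprime w (int p)"
  shows "unit_sq_class p e (e * w\<^sup>2)"
  unfolding unit_sq_class_def by (intro allI exI[of _ w] conjI assms cong_refl)

text \<open>The derivative \<open>2 * e * x\<close> of \<open>e * x^2 - m\<close> is a unit, so a
  root modulo \<open>p\<close> lifts.\<close>

lemma unit_sq_class_odd:
  assumes "prime p" "odd p" and "coprime e (int p)" "[e * x\<^sup>2 = m] (mod int p)" "coprime m (int p)"
  shows "unit_sq_class p e m"
proof (rule unit_sq_classI)
  fix k
  have "coprime (e * x\<^sup>2) (int p)" using assms(4,5) cong_imp_coprime cong_sym by blast
  then have x: "coprime x (int p)" by simp
  have "coprime 2 (int p)" using assms(2) by simp
  then have "coprime (2 * e * x) (int p)" using assms(3) x by simp
  moreover have "[e * x\<^sup>2 + 0 * x + (-m) = 0] (mod int p ^ (2 * 0 + 1))"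
    using assms(4) by (simp add: cong_iff_dvd_diff)
  ultimately obtain y where y: "[y = x] (mod int p ^ Suc 0)" "[e * y\<^sup>2 + 0 * y + (-m) = 0] (mod int p ^ Suc k)"
    using hensel_quadratic[OF assms(1), of e x 0 "-m" 0 "2 * e * x" "Suc k"] by auto
  then have "coprime y (int p)" using x cong_imp_coprime cong_sym by (metis power_Suc0_right)
  then show "\<exists>x. coprime x (int p) \<and> [e * x\<^sup>2 = m] (mod int p ^ Suc k)"
    using y(2) by (auto simp: cong_iff_dvd_diff)
qed

text \<open>The derivative at 1 is \<open>2 * e\<close>, of order 1, so a root is needed modulo
  \<open>2^(2*1+1) = 8\<close>.\<close>

lemma unit_sq_class_two:
  assumes "odd e" "[e = m] (mod 8)"
  shows "unit_sq_class 2 e m"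
proof (rule unit_sq_classI)
  fix k
  have "[e * 1\<^sup>2 + 0 * 1 + (-m) = 0] (mod int 2 ^ (2 * 1 + 1))"
    using assms(2) by (simp add: cong_iff_dvd_diff)
  then obtain y where y: "[y = 1] (mod int 2 ^ Suc 1)" "[e * y\<^sup>2 + 0 * y + (-m) = 0] (mod int 2 ^ Suc k)"
    using hensel_quadratic[of 2 e 1 0 "-m" 1 e "Suc k"] assms(1) by auto
  have "odd y"
  proof -
    have "4 dvd y - 1" using y(1) by (simp add: cong_iff_dvd_diff)
    then show ?thesis by presburger
  qed
  then show "\<exists>x. coprime x (int 2) \<and> [e * x\<^sup>2 = m] (mod int 2 ^ Suc k)"
    using y(2) by (auto simp: cong_iff_dvd_diff)
qed

section \<open>Non-residues and representatives of square classes\<close>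

lemma Delta_props:
  assumes "prime p" "odd p"
  shows "Delta p > 1" "coprime (Delta p) (int p)" "\<not> QuadRes (int p) (Delta p)"
    and "\<exists>y. [y\<^sup>2 = Delta p - 1] (mod int p)"
proof -
  let ?P = "\<lambda>d::nat. d > 0 \<and> \<not> (\<exists>y::int. [y^2 = int d] (mod int p))"
  have p2: "p > 2" using assms by (metis dvd_refl le_neq_implies_less prime_ge_2_nat)
  \<comment> \<open>If every nonzero residue were a square, squaring would be injective on the
    nonzero residues, but 1 and -1 have the same square.\<close>
  have "\<exists>d. ?P d"
  proof -
    have "\<exists>x\<in>{1..<p}. \<not> (\<exists>y::int. [y^2 = int x] (mod int p))"
    proof (rule ccontr)
      assume "\<not> ?thesis"
      then have all: "\<exists>y::int. [y^2 = int x] (mod int p)" if "x \<in> {1..<p}" for x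
        using that by blast
      let ?f = "\<lambda>y::int. y^2 mod int p"
      have "{1..<int p} \<subseteq> ?f ` {1..<int p}"
      proof
        fix x assume x: "x \<in> {1..<int p}"
        then have "nat x \<in> {1..<p}" by auto
        then obtain y where y: "[y^2 = x] (mod int p)" using all[of "nat x"] x by auto
        have e: "?f (y mod int p) = x"
          using y x by (simp add: cong_def power_mod)
        have "y mod int p \<noteq> 0" using e x by (intro notI) auto
        moreover have "0 \<le> y mod int p" "y mod int p < int p" using p2 by auto
        ultimately have "y mod int p \<in> {1..<int p}" by auto
        then show "x \<in> ?f ` {1..<int p}" using e by (metis imageI)
      qed
      then have "card {1..<int p} \<le> card (?f ` {1..<int p})" by (intro card_mono) auto
      then have "card (?f ` {1..<int p}) = card {1..<int p}"
        by (meson card_image_le finite_atLeastLessThan_int le_antisym)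
      then have "inj_on ?f {1..<int p}" by (simp add: eq_card_imp_inj_on)
      moreover have "?f 1 = ?f (int p - 1)"
      proof -
        have "(int p - 1)^2 - 1 = int p * (int p - 2)" by (simp add: power2_eq_square algebra_simps)
        then have "int p dvd (int p - 1)^2 - 1^2" by simp
        then show ?thesis unfolding mod_eq_dvd_iff by (simp add: dvd_diff_commute)
      qed
      moreover have "1 \<in> {1..<int p}" "int p - 1 \<in> {1..<int p}" using p2 by auto
      ultimately have "1 = int p - 1" by (rule inj_onD)
      then show False using p2 by auto
    qed
    then obtain x where "x \<in> {1..<p}" "\<not> (\<exists>y::int. [y^2 = int x] (mod int p))" by blast
    then show ?thesis by (intro exI[of _ x]) auto
  qed
  then have "?P (LEAST d. ?P d)" by (rule LeastI_ex)
  then have D: "Delta p > 0" "\<not> (\<exists>y::int. [y^2 = Delta p] (mod int p))"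
    unfolding Delta_def by auto
  show "\<not> QuadRes (int p) (Delta p)" using D(2) by (simp add: QuadRes_def)
  have "Delta p \<noteq> 1" using D(2) by (metis cong_refl one_power2)
  then show D1: "Delta p > 1" using D(1) by simp
  show "coprime (Delta p) (int p)"
  proof (rule ccontr)
    assume "\<not> coprime (Delta p) (int p)"
    then have "int p dvd Delta p"
      using assms(1) prime_imp_coprime[of "int p" "Delta p"] by (auto simp: coprime_commute)
    then have "[0\<^sup>2 = Delta p] (mod int p)" by (simp add: cong_iff_dvd_diff)
    then show False using D(2) by blast
  qed
  have "\<not> ?P (nat (Delta p - 1))"
    by (rule not_less_Least) (use D1 in \<open>simp add: Delta_def\<close>)
  then show "\<exists>y. [y\<^sup>2 = Delta p - 1] (mod int p)" using D1 by auto
qed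

text \<open>These represent the square classes of p-adic units; \<open>SC p\<close> and
  \<open>Bp nub p\<close> consist of powers of \<open>p\<close> times these numbers.\<close>

definition unit_reps :: "nat \<Rightarrow> int set" where
  "unit_reps p = (if p = 2 then {1, 3, 5, 7} else {1, Delta p})"

lemma unit_reps_coprime:
  assumes "prime p" "b \<in> unit_reps p"
  shows "coprime b (int p)"
proof (cases "p = 2")
  case False
  then have "odd p" using assms(1) odd_prime_if_not_2 by blast
  then show ?thesis using Delta_props(2)[OF assms(1)] assms(2) False by (auto simp: unit_reps_def)
qed (use assms in \<open>auto simp: unit_reps_def\<close>)

text \<open>For \<open>p = 2\<close> the residue modulo 8 decides. For odd \<open>p\<close> Euler's
  criterion makes the product of the non-residues \<open>a\<close> and \<open>Delta p\<close> a
  residue.\<close>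

lemma unit_class_rep:
  assumes p: "prime p" and a: "coprime a (int p)"
  shows "\<exists>b\<in>unit_reps p. unit_sq_class p b a"
proof (cases "p = 2")
  case True
  then have "odd a" using a by simp
  then have "a mod 8 \<in> {1, 3, 5, 7}" "odd (a mod 8)" by (simp, presburger) (use \<open>odd a\<close> in presburger)
  moreover have "unit_sq_class 2 (a mod 8) a"
    using calculation(2) by (intro unit_sq_class_two) auto
  ultimately show ?thesis using True by (auto simp: unit_reps_def)
next
  case False
  then have p2: "p > 2" and odd: "odd p"
    using p prime_ge_2_nat[OF p] odd_prime_if_not_2 by auto
  let ?D = "Delta p"
  note D = Delta_props[OF p odd]
  show ?thesis
  proof (cases "QuadRes (int p) a")
    case True
    then obtain y where "[1 * y\<^sup>2 = a] (mod int p)" by (auto simp: QuadRes_def)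
    then have "unit_sq_class p 1 a" using p odd a by (intro unit_sq_class_odd) auto
    then show ?thesis using False by (auto simp: unit_reps_def)
  next
    case nr: False
    let ?m = "(p - 1) div 2"
    have nz: "\<not> [x = 0] (mod int p)" if "coprime x (int p)" for x
    proof
      assume "[x = 0] (mod int p)"
      then have "is_unit (int p)" using that coprime_common_divisor[of x "int p" "int p"] by (simp add: cong_0_iff)
      then show False using p2 by simp
    qed
    have "[-1 = a ^ ?m] (mod int p)" "[-1 = ?D ^ ?m] (mod int p)"
      using euler_criterion[OF p p2, of a] euler_criterion[OF p p2, of ?D] nz[OF a] nz[OF D(2)] nr D(3)
      by (auto simp: Legendre_def)
    then have "[(-1) * (-1) = a ^ ?m * ?D ^ ?m] (mod int p)" by (rule cong_mult)
    then have "[1 = (a * ?D) ^ ?m] (mod int p)" by (simp add: power_mult_distrib)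
    then have L: "[Legendre (a * ?D) (int p) = 1] (mod int p)"
      using euler_criterion[OF p p2, of "a * ?D"] by (metis cong_trans cong_sym)
    \<comment> \<open>Modulo a prime above 2 the values 0 and -1 of the Legendre symbol are not
      congruent to 1.\<close>
    have "\<not> [0 = 1] (mod int p)" using nz[of 1] by (simp add: cong_sym_eq)
    moreover have "\<not> [-1 = 1] (mod int p)"
    proof
      assume "[-1 = 1] (mod int p)"
      then have "int p dvd 2" by (metis cong_iff_dvd_diff dvd_minus_iff minus_diff_eq one_add_one diff_minus_eq_add)
      then show False using p2 zdvd_imp_le by fastforce
    qed
    ultimately have "QuadRes (int p) (a * ?D)" using L by (auto simp: Legendre_def split: if_splits)
    then obtain y where y: "[y\<^sup>2 = a * ?D] (mod int p)" by (auto simp: QuadRes_def)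
    \<comment> \<open>With \<open>z = 1 / Delta p\<close>, the relation
      \<open>y^2 = a * Delta p\<close> reads \<open>a = Delta p * (z * y)^2\<close>.\<close>
    obtain z where z: "[?D * z = 1] (mod int p)" using D(2) cong_solve_coprime_int by blast
    have "[z\<^sup>2 * ?D * y\<^sup>2 = z\<^sup>2 * ?D * (a * ?D)] (mod int p)" using y by (rule cong_scalar_left)
    also have "z\<^sup>2 * ?D * (a * ?D) = (?D * z)\<^sup>2 * a" by (simp add: power2_eq_square)
    also have "[(?D * z)\<^sup>2 * a = 1\<^sup>2 * a] (mod int p)" using z by (intro cong_mult cong_refl cong_pow)
    finally have "[?D * (z * y)\<^sup>2 = a] (mod int p)" by (simp add: power_mult_distrib mult_ac)
    then have "unit_sq_class p ?D a" using p odd a D(2) by (intro unit_sq_class_odd) auto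
    then show ?thesis using False by (auto simp: unit_reps_def)
  qed
qed

lemma class_rep:
  assumes p: "prime p" and a: "a \<noteq> 0"
  shows "\<exists>b\<in>unit_reps p. unit_sq_class p (int p ^ multiplicity (int p) a * b) a"
proof -
  have "\<not> is_unit (int p)" using p by (metis not_prime_unit prime_nat_int_transfer)
  then obtain y where y: "a = int p ^ multiplicity (int p) a * y" "\<not> int p dvd y"
    using multiplicity_decompose'[of a "int p"] a by metis
  have "coprime y (int p)" using y(2) p prime_imp_coprime[of "int p" y] by (auto simp: coprime_commute)
  then obtain b where "b \<in> unit_reps p" "unit_sq_class p b y" using unit_class_rep p by blast
  then show ?thesis using unit_sq_class_mult[of p b y "int p ^ multiplicity (int p) a"] y(1) by metis
qed

subsection \<open>Bilinear forms and local representations\<close>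

lemma bform_add_left: "bform n G (\<lambda>i. x i + y i) z = bform n G x z + bform n G y z"
  by (simp add: bform_def algebra_simps sum.distrib)

lemma bform_add_right: "bform n G z (\<lambda>i. x i + y i) = bform n G z x + bform n G z y"
  by (simp add: bform_def algebra_simps sum.distrib)

lemma bform_scale_left: "bform n G (\<lambda>i. c * x i) z = c * bform n G x z"
  by (simp add: bform_def algebra_simps sum_distrib_left)

lemma bform_scale_right: "bform n G z (\<lambda>i. c * x i) = c * bform n G z x"
  by (simp add: bform_def algebra_simps sum_distrib_left)

lemma bform_zero_left: "bform n G (\<lambda>i. 0) z = 0" and bform_zero_right: "bform n G z (\<lambda>i. 0) = 0"
  by (simp_all add: bform_def)

lemma bform_sum_left: "bform n G (\<lambda>i. \<Sum>k\<in>K. x k i) z = (\<Sum>k\<in>K. bform n G (x k) z)"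
  by (induction K rule: infinite_finite_induct)
    (simp_all add: bform_add_left bform_zero_left)

lemma bform_sum_right: "bform n G z (\<lambda>i. \<Sum>k\<in>K. x k i) = (\<Sum>k\<in>K. bform n G z (x k))"
  by (induction K rule: infinite_finite_induct)
    (simp_all add: bform_add_right bform_zero_right)

lemma bform_commute:
  assumes "zlattice n G"
  shows "bform n G x y = bform n G y x"
proof -
  have "bform n G x y = (\<Sum>j<n. \<Sum>i<n. G i j * x i * y j)"
    unfolding bform_def by (rule sum.swap)
  also have "\<dots> = bform n G y x"
    unfolding bform_def using assms by (intro sum.cong refl) (auto simp: zlattice_def)
  finally show ?thesis .
qed

lemma qform_scale: "qform n G (\<lambda>i. c * x i) = c\<^sup>2 * qform n G x"
  by (simp add: qform_def bform_scale_left bform_scale_right power2_eq_square)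

lemma qform_lincomb2:
  assumes "zlattice n G"
  shows "qform n G (\<lambda>i. c * x i + y i) = qform n G x * c\<^sup>2 + 2 * bform n G x y * c + qform n G y"
  using bform_commute[OF assms, of y x]
  by (simp add: qform_def bform_add_left bform_add_right bform_scale_left bform_scale_right
      power2_eq_square algebra_simps)

lemma bform_lincomb:
  "bform n G (\<lambda>i. \<Sum>k\<in>K. c k * x k i) (\<lambda>i. \<Sum>l\<in>L. d l * y l i)
    = (\<Sum>k\<in>K. \<Sum>l\<in>L. c k * d l * bform n G (x k) (y l))"
  by (simp add: bform_sum_left bform_sum_right bform_scale_left bform_scale_right sum_distrib_left mult_ac)

lemma vecs_add: "x \<in> vecs n \<Longrightarrow> y \<in> vecs n \<Longrightarrow> (\<lambda>i. x i + y i) \<in> vecs n"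
  and vecs_scale: "x \<in> vecs n \<Longrightarrow> (\<lambda>i. c * x i) \<in> vecs n"
  and vecs_sum: "(\<And>k. k \<in> K \<Longrightarrow> f k \<in> vecs n) \<Longrightarrow> (\<lambda>i. \<Sum>k\<in>K. a k * f k i) \<in> vecs n"
  by (auto simp: vecs_def)

lemma qform_nonneg:
  assumes "zlattice n G" "x \<in> vecs n"
  shows "qform n G x \<ge> 0" "qform n G x = 0 \<longleftrightarrow> x = (\<lambda>_. 0)"
proof -
  have "qform n G (\<lambda>_. 0) = 0" by (simp add: qform_def bform_def)
  then show "qform n G x \<ge> 0" "qform n G x = 0 \<longleftrightarrow> x = (\<lambda>_. 0)"
    using assms by (force simp: zlattice_def)+
qed

lemma loc_rep_cong_class:
  assumes "loc_rep p n G e" "unit_sq_class p e m"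
  shows "loc_rep p n G m"
  unfolding loc_rep_def
proof
  fix k
  obtain x where x: "x \<in> vecs n" "[qform n G x = e] (mod int p ^ k)"
    using assms(1) unfolding loc_rep_def by blast
  obtain y where y: "[e * y\<^sup>2 = m] (mod int p ^ k)"
    using assms(2) unfolding unit_sq_class_def by blast
  have "[qform n G (\<lambda>i. y * x i) = e * y\<^sup>2] (mod int p ^ k)"
    using cong_scalar_left[OF x(2), of "y\<^sup>2"] by (simp add: qform_scale mult_ac)
  then show "\<exists>x\<in>vecs n. [qform n G x = m] (mod int p ^ k)"
    using y vecs_scale[OF x(1), of y] cong_trans by blast
qed

lemma loc_rep_square_mult:
  assumes "loc_rep p n G a"
  shows "loc_rep p n G (c\<^sup>2 * a)"
  unfolding loc_rep_def
proof
  fix k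
  obtain x where x: "x \<in> vecs n" "[qform n G x = a] (mod int p ^ k)"
    using assms(1) unfolding loc_rep_def by blast
  have "[qform n G (\<lambda>i. c * x i) = c\<^sup>2 * a] (mod int p ^ k)"
    using cong_scalar_left[OF x(2), of "c\<^sup>2"] by (simp add: qform_scale mult_ac)
  then show "\<exists>x\<in>vecs n. [qform n G x = c\<^sup>2 * a] (mod int p ^ k)"
    using vecs_scale[OF x(1), of c] by blast
qed

lemma loc_rep_qvals: "a \<in> qvals n G \<Longrightarrow> loc_rep p n G a"
  unfolding loc_rep_def qvals_def using cong_refl by blast

section \<open>Diagonal forms\<close>

definition diag :: "(nat \<Rightarrow> int) \<Rightarrow> nat \<Rightarrow> nat \<Rightarrow> int" where
  "diag d i j = (if i = j then d i else 0)"

lemma qform_diag: "qform n (diag d) x = (\<Sum>i<n. d i * (x i)\<^sup>2)"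
proof -
  have "(\<Sum>j<n. diag d i j * x i * x j) = d i * (x i)\<^sup>2" if "i < n" for i
  proof -
    have "(\<Sum>j<n. diag d i j * x i * x j) = (\<Sum>j<n. if i = j then d i * (x i)\<^sup>2 else 0)"
      by (intro sum.cong) (auto simp: diag_def power2_eq_square)
    then show ?thesis using that by simp
  qed
  then show ?thesis by (simp add: qform_def bform_def)
qed

lemma loc_rep_diag_iff:
  "loc_rep p n (diag d) a \<longleftrightarrow> (\<forall>k. \<exists>x. [(\<Sum>i<n. d i * (x i)\<^sup>2) = a] (mod int p ^ k))"
proof -
  have "(\<exists>x\<in>vecs n. [qform n (diag d) x = a] (mod q)) \<longleftrightarrow> (\<exists>x. [(\<Sum>i<n. d i * (x i)\<^sup>2) = a] (mod q))"
    (is "?l \<longleftrightarrow> ?r") for q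
  proof
    assume ?r
    then obtain x where x: "[(\<Sum>i<n. d i * (x i)\<^sup>2) = a] (mod q)" by blast
    let ?x = "\<lambda>i. if i < n then x i else 0"
    have "?x \<in> vecs n" by (simp add: vecs_def)
    moreover have "qform n (diag d) ?x = (\<Sum>i<n. d i * (x i)\<^sup>2)" by (simp add: qform_diag)
    ultimately show ?l using x by metis
  qed (auto simp: qform_diag)
  then show ?thesis by (simp add: loc_rep_def)
qed

text \<open>By minimality of \<open>Delta p\<close>, the number \<open>Delta p - 1\<close> is a square modulo \<open>p\<close>.\<close>

lemma odd_sum_two_squares:
  assumes p: "prime p" "odd p" and u: "coprime u (int p)" and c: "coprime c (int p)"
  shows "\<exists>x y. [u * (x\<^sup>2 + y\<^sup>2) = c] (mod int p ^ k)"
proof -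
  obtain z where z: "[u * z = 1] (mod int p)" using u cong_solve_coprime_int by blast
  have p2: "p \<noteq> 2" using p by auto
  have "coprime (u * z) (int p)" using z by (metis cong_imp_coprime cong_sym coprime_1_left)
  then have "coprime (z * c) (int p)" using c by simp
  \<comment> \<open>It suffices to write the representative \<open>b\<close> of the class of
    \<open>c / u\<close> as \<open>1 + y^2\<close> modulo \<open>p\<close>; the factor
    \<open>w\<close> then leads to \<open>c / u\<close> itself.\<close>
  then obtain b where b: "b \<in> unit_reps p" "unit_sq_class p b (z * c)"
    using unit_class_rep p(1) by blast
  obtain w where w: "[b * w\<^sup>2 = z * c] (mod int p ^ 1)" using b(2) unfolding unit_sq_class_def by blast
  obtain y where y: "[1 + y\<^sup>2 = b] (mod int p)"
  proof (cases "b = 1")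
    case True
    then show ?thesis using that[of 0] by simp
  next
    case False
    then have "b = Delta p" using b(1) p2 by (auto simp: unit_reps_def)
    then show ?thesis using that Delta_props(4)[OF p] cong_add[OF cong_refl[of 1]] by fastforce
  qed
  define s where "s = u * ((w)\<^sup>2 + (y * w)\<^sup>2)"
  have "s = u * ((1 + y\<^sup>2) * w\<^sup>2)" by (simp add: s_def power_mult_distrib algebra_simps)
  also have "[u * ((1 + y\<^sup>2) * w\<^sup>2) = u * (b * w\<^sup>2)] (mod int p)"
    using y by (intro cong_mult cong_refl)
  also have "[u * (b * w\<^sup>2) = u * (z * c)] (mod int p)"
    using cong_scalar_left[OF w] by simp
  also have "u * (z * c) = (u * z) * c" by simp
  also have "[(u * z) * c = 1 * c] (mod int p)" using z by (intro cong_mult cong_refl)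
  finally have s: "[s = c] (mod int p)" by simp
  then have "coprime s (int p)" using c cong_imp_coprime cong_sym by blast
  then have "unit_sq_class p s c" using s p c by (intro unit_sq_class_odd[of _ _ 1]) auto
  then obtain v where "[s * v\<^sup>2 = c] (mod int p ^ k)" unfolding unit_sq_class_def by blast
  moreover have "s * v\<^sup>2 = u * ((w * v)\<^sup>2 + (y * w * v)\<^sup>2)"
    by (simp add: s_def power_mult_distrib algebra_simps)
  ultimately show ?thesis by metis
qed

subsection \<open>Quaternary forms over the p-adic integers\<close>

text \<open>Pigeonhole: if neither 1 occurs nor \<open>Delta p\<close> twice, three coefficients are
  divisible by \<open>p\<close>, and two of these three have the same unit part. Two equal units
  represent every unit.\<close>

lemma quaternary_odd:
  assumes p: "prime p" "odd p" and e: "\<And>i. i < 4 \<Longrightarrow> e i \<in> SC p"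
  shows "\<exists>u. loc_rep p 4 (diag e) (int p ^ (2 * u))"
proof -
  have p2: "p \<noteq> 2" using p by auto
  have SC: "SC p = {1, Delta p, int p, int p * Delta p}" using p2 by (simp add: SC_def)
  note D = Delta_props[OF p]
  consider (one) i where "i < 4" "e i = 1"
    | (two) i j where "i < 4" "j < 4" "i \<noteq> j" "e i = Delta p" "e j = Delta p"
    | (three) i j k u v where "i < 4" "j < 4" "k < 4" "i \<noteq> j" "i \<noteq> k" "j \<noteq> k"
        "e i = int p * u" "e j = int p * u" "e k = int p * v" "u \<in> {1, Delta p}" "v \<in> {1, Delta p}"
  proof -
    have e4: "e 0 \<in> SC p" "e 1 \<in> SC p" "e 2 \<in> SC p" "e 3 \<in> SC p" using e by auto
    define P where "P i \<longleftrightarrow> (\<exists>u\<in>{1, Delta p}. e i = int p * u)" for i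
    have cl: "e i = 1 \<or> e i = Delta p \<or> P i" if "i < 4" for i
      using e[OF that] unfolding SC P_def by auto
    have "(\<exists>i<4. e i = 1) \<or> (\<exists>i<4. \<exists>j<4. i \<noteq> j \<and> e i = Delta p \<and> e j = Delta p) \<or>
      (\<exists>i<4. \<exists>j<4. \<exists>k<4. i \<noteq> j \<and> i \<noteq> k \<and> j \<noteq> k \<and> P i \<and> P j \<and> P k)"
      using cl[of 0] cl[of 1] cl[of 2] cl[of 3]
      by (simp add: numeral_eq_Suc Ex_less_Suc2) metis
    then show thesis
    proof (elim disjE exE conjE)
      fix i j k assume ijk: "i < 4" "j < 4" "k < 4" "i \<noteq> j" "i \<noteq> k" "j \<noteq> k" "P i" "P j" "P k"
      obtain a where a: "a \<in> {1, Delta p}" "e i = int p * a" using ijk unfolding P_def by blast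
      obtain b where b: "b \<in> {1, Delta p}" "e j = int p * b" using ijk unfolding P_def by blast
      obtain c where c: "c \<in> {1, Delta p}" "e k = int p * c" using ijk unfolding P_def by blast
      consider "a = b" | "a = c" | "b = c" using a(1) b(1) c(1) by auto
      then show thesis
      proof cases
        case 1 then show thesis using three[of i j k a c] ijk a b c by auto
      next
        case 2 then show thesis using three[of i k j a b] ijk a b c by auto
      next
        case 3 then show thesis using three[of j k i b a] ijk a b c by auto
      qed
    qed (use one two in blast)+
  qed
  then show ?thesis
  proof cases
    case one
    have "loc_rep p 4 (diag e) 1"
      unfolding loc_rep_diag_iff
    proof (intro allI exI)
      fix k
      have "(\<Sum>l<4. e l * ((\<lambda>_. 0)(i := 1)) l ^ 2) = (\<Sum>l\<in>{i}. e l * ((\<lambda>_. 0)(i := 1)) l ^ 2)"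
        using one by (intro sum.mono_neutral_right) auto
      then show "[(\<Sum>l<4. e l * ((\<lambda>_. 0)(i := 1)) l ^ 2) = 1] (mod int p ^ k)"
        using one by simp
    qed
    then show ?thesis by (intro exI[of _ 0]) simp
  next
    case two
    have "loc_rep p 4 (diag e) 1"
      unfolding loc_rep_diag_iff
    proof
      fix k
      obtain x y where xy: "[Delta p * (x\<^sup>2 + y\<^sup>2) = 1] (mod int p ^ k)"
        using odd_sum_two_squares[OF p D(2) coprime_1_left] by blast
      let ?z = "(\<lambda>_. 0)(i := x, j := y)"
      have "(\<Sum>l<4. e l * ?z l ^ 2) = (\<Sum>l\<in>{i, j}. e l * ?z l ^ 2)"
        using two by (intro sum.mono_neutral_right) auto
      also have "\<dots> = Delta p * (x\<^sup>2 + y\<^sup>2)" using two by (simp add: algebra_simps)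
      finally show "\<exists>z. [(\<Sum>l<4. e l * (z l)\<^sup>2) = 1] (mod int p ^ k)" using xy by metis
    qed
    then show ?thesis by (intro exI[of _ 0]) simp
  next
    case three
    have u: "coprime u (int p)" and v: "coprime v (int p)" using three D(2) by auto
    \<comment> \<open>With the unit \<open>p - v\<close> as value of \<open>u * (x^2 + y^2)\<close>,
      the bracket \<open>u * (x^2 + y^2) + v\<close> becomes \<open>p\<close> and the form takes the
      value \<open>p^2\<close>.\<close>
    have "[- v = int p - v] (mod int p)" by (simp add: cong_iff_dvd_diff)
    moreover have "coprime (- v) (int p)" using v by simp
    ultimately have pv: "coprime (int p - v) (int p)" by (rule cong_imp_coprime)
    have "loc_rep p 4 (diag e) (int p ^ 2)"
      unfolding loc_rep_diag_iff
    proof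
      fix m
      obtain x y where xy: "[u * (x\<^sup>2 + y\<^sup>2) = int p - v] (mod int p ^ m)"
        using odd_sum_two_squares[OF p u pv] by blast
      let ?z = "(\<lambda>_. 0)(i := x, j := y, k := 1)"
      have "(\<Sum>l<4. e l * ?z l ^ 2) = (\<Sum>l\<in>{i, j, k}. e l * ?z l ^ 2)"
        using three by (intro sum.mono_neutral_right) auto
      also have "\<dots> = int p * (u * (x\<^sup>2 + y\<^sup>2) + v)" using three by (simp add: algebra_simps)
      finally have *: "(\<Sum>l<4. e l * ?z l ^ 2) = int p * (u * (x\<^sup>2 + y\<^sup>2) + v)" .
      have "[int p * (u * (x\<^sup>2 + y\<^sup>2) + v) = int p * ((int p - v) + v)] (mod int p ^ m)"
        using xy by (intro cong_scalar_left cong_add cong_refl)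
      then have "[(\<Sum>l<4. e l * ?z l ^ 2) = (int p)\<^sup>2] (mod int p ^ m)"
        unfolding * by (simp add: power2_eq_square)
      then show "\<exists>z. [(\<Sum>l<4. e l * (z l)\<^sup>2) = (int p)\<^sup>2] (mod int p ^ m)" by blast
    qed
    then show ?thesis by (intro exI[of _ 1]) simp
  qed
qed

text \<open>Satisfied only by squares of \<open>\<int>\<^sub>2\<close>: 1 or 4 times a unit congruent to 1 modulo 8.\<close>

definition two_adic_hit :: "int \<Rightarrow> bool" where
  "two_adic_hit v \<longleftrightarrow> v mod 8 = 1 \<or> v mod 32 = 4"

text \<open>The witness vectors come from a computer search over small coordinates; a larger number of
  variables is tried only for those coefficients for which no shorter form works.\<close>

lemma two_adic_check:
  "list_all (\<lambda>a. list_all (\<lambda>b.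
     list_ex (\<lambda>(x, y). two_adic_hit (a * x * x + b * y * y)) [(1, 3), (2, 1), (1, 1), (1, 2)] \<or>
     list_all (\<lambda>c.
       list_ex (\<lambda>(x, y, z). two_adic_hit (a * x * x + b * y * y + c * z * z))
         [(0, 1, 3), (3, 0, 1), (1, 1, 2), (1, 3, 3), (1, 2, 1), (2, 1, 1), (2, 2, 1), (1, 3, 2),
          (0, 1, 1), (1, 0, 1), (1, 2, 3), (2, 1, 3), (0, 2, 1)] \<or>
       list_all (\<lambda>d.
         list_ex (\<lambda>(x, y, z, w). two_adic_hit (a * x * x + b * y * y + c * z * z + d * w * w))
           [(0, 0, 1, 3), (0, 3, 0, 1), (1, 1, 1, 2), (1, 2, 1, 2), (1, 0, 0, 3), (1, 1, 3, 1),
            (1, 0, 1, 3), (0, 1, 3, 3), (1, 1, 0, 1)])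
         [3, 5, 7, 2, 6, 10, 14])
       [3, 5, 7, 2, 6, 10, 14])
     [3, 5, 7, 2, 6, 10, 14])
   [3, 5, 7, 2, 6, 10, 14]"
  by code_simp

text \<open>A coefficient 1 gives the hit 1 at once, which is why the check leaves it out; hits in
  fewer variables are padded with zeros.\<close>

lemma two_adic_hit:
  fixes a b c d :: int
  assumes "a \<in> SC 2" "b \<in> SC 2" "c \<in> SC 2" "d \<in> SC 2"
  shows "\<exists>x y z w. two_adic_hit (a * x\<^sup>2 + b * y\<^sup>2 + c * z\<^sup>2 + d * w\<^sup>2)"
proof (cases "a = 1 \<or> b = 1 \<or> c = 1 \<or> d = 1")
  case True
  have hit: "two_adic_hit 1" by (simp add: two_adic_hit_def)
  consider "a = 1" | "b = 1" | "c = 1" | "d = 1" using True by blast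
  then show ?thesis
  proof cases
    case 1
    show ?thesis
      by (rule exI[of _ "1::int"], rule exI[of _ "0::int"], rule exI[of _ "0::int"], rule exI[of _ "0::int"]) (simp add: 1 hit)
  next
    case 2
    show ?thesis
      by (rule exI[of _ "0::int"], rule exI[of _ "1::int"], rule exI[of _ "0::int"], rule exI[of _ "0::int"]) (simp add: 2 hit)
  next
    case 3
    show ?thesis
      by (rule exI[of _ "0::int"], rule exI[of _ "0::int"], rule exI[of _ "1::int"], rule exI[of _ "0::int"]) (simp add: 3 hit)
  next
    case 4
    show ?thesis
      by (rule exI[of _ "0::int"], rule exI[of _ "0::int"], rule exI[of _ "0::int"], rule exI[of _ "1::int"]) (simp add: 4 hit)
  qed
next
  case False
  let ?S = "[3, 5, 7, 2, 6, 10, 14] :: int list"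
  have S: "a \<in> set ?S" "b \<in> set ?S" "c \<in> set ?S" "d \<in> set ?S"
    using False assms by (auto simp: SC_def)
  have sq: "t * x * x = t * x\<^sup>2" for t x :: int by (simp add: power2_eq_square)
  have "(\<exists>x y. two_adic_hit (a * x\<^sup>2 + b * y\<^sup>2)) \<or>
      (\<exists>x y z. two_adic_hit (a * x\<^sup>2 + b * y\<^sup>2 + c * z\<^sup>2)) \<or>
      (\<exists>x y z w. two_adic_hit (a * x\<^sup>2 + b * y\<^sup>2 + c * z\<^sup>2 + d * w\<^sup>2))"
    using two_adic_check S unfolding list_all_iff list_ex_iff sq by fast
  then show ?thesis
  proof (elim disjE exE)
    fix x y assume "two_adic_hit (a * x\<^sup>2 + b * y\<^sup>2)"
    then show ?thesis by (intro exI[of _ x] exI[of _ y] exI[of _ 0]) simp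
  next
    fix x y z assume "two_adic_hit (a * x\<^sup>2 + b * y\<^sup>2 + c * z\<^sup>2)"
    then show ?thesis by (intro exI[of _ x] exI[of _ y] exI[of _ z] exI[of _ 0]) simp
  qed blast
qed

lemma quaternary_two:
  assumes e: "\<And>i. i < 4 \<Longrightarrow> e i \<in> SC 2"
  shows "\<exists>u. loc_rep 2 4 (diag e) (int 2 ^ (2 * u))"
proof -
  obtain v x y z w where h: "two_adic_hit v"
    and v: "v = e 0 * x\<^sup>2 + e 1 * y\<^sup>2 + e 2 * z\<^sup>2 + e 3 * w\<^sup>2"
    using two_adic_hit[of "e 0" "e 1" "e 2" "e 3"] e by auto
  have lr: "loc_rep 2 4 (diag e) v"
    unfolding loc_rep_diag_iff
  proof (intro allI exI)
    fix k
    show "[(\<Sum>i<4. e i * ((\<lambda>_. w)(0 := x, 1 := y, 2 := z)) i ^ 2) = v] (mod int 2 ^ k)"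
      unfolding v by (simp add: numeral_eq_Suc)
  qed
  have "\<exists>u. unit_sq_class 2 v (int 2 ^ (2 * u))"
  proof (cases "v mod 8 = 1")
    case True
    then have "odd v" by presburger
    then have "unit_sq_class 2 v 1" using True by (intro unit_sq_class_two) (auto simp: cong_def)
    then show ?thesis by (intro exI[of _ 0]) simp
  next
    case False
    then have m: "v mod 32 = 4" using h by (simp add: two_adic_hit_def)
    define r where "r = 8 * (v div 32) + 1"
    have r: "v = 4 * r" "r mod 8 = 1" "odd r"
      using div_mult_mod_eq[of v 32] unfolding m r_def by auto
    then have "unit_sq_class 2 r 1" using r(2,3) by (intro unit_sq_class_two) (auto simp: cong_def)
    then have "unit_sq_class 2 v 4" unfolding r(1) using unit_sq_class_mult[of 2 r 1 4] by simp
    then show ?thesis by (intro exI[of _ 1]) simp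
  qed
  then show ?thesis using lr loc_rep_cong_class by blast
qed

text \<open>Up to squares only the parity of the exponent of \<open>p\<close> matters, and
  \<open>SC p\<close> contains every unit representative with both parities.\<close>

lemma SC_reps:
  assumes "b \<in> unit_reps p"
  shows "int p ^ (m mod 2) * b \<in> SC p"
proof -
  have "m mod 2 = 0 \<or> m mod 2 = 1" by auto
  then show ?thesis using assms by (auto simp: SC_def unit_reps_def split: if_splits)
qed

text \<open>Multiplying the form by \<open>s\<close> reduces the value \<open>s\<close> to the value 1 up to squares.\<close>

lemma quaternary_universal:
  assumes p: "prime p" and d: "\<And>i. i < 4 \<Longrightarrow> d i \<noteq> 0" and s: "s \<noteq> 0"
  shows "\<exists>u. loc_rep p 4 (diag d) (s * int p ^ (2 * u))"
proof -
  define m where "m i = multiplicity (int p) (s * d i)" for i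
  have "\<exists>b\<in>unit_reps p. unit_sq_class p (int p ^ m i * b) (s * d i)" if "i < 4" for i
    unfolding m_def using class_rep[OF p, of "s * d i"] d[OF that] s by auto
  then obtain b where b: "\<And>i. i < 4 \<Longrightarrow> b i \<in> unit_reps p"
    "\<And>i. i < 4 \<Longrightarrow> unit_sq_class p (int p ^ m i * b i) (s * d i)" by metis
  define e where "e i = int p ^ (m i mod 2) * b i" for i
  have e: "e i \<in> SC p" if "i < 4" for i unfolding e_def by (rule SC_reps[OF b(1)[OF that]])
  have "\<exists>u. loc_rep p 4 (diag e) (int p ^ (2 * u))"
  proof (cases "p = 2")
    case True
    then show ?thesis using quaternary_two[of e] e by auto
  next
    case False
    then have "odd p" using p odd_prime_if_not_2 by blast
    then show ?thesis using quaternary_odd[OF p] e by blast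
  qed
  then obtain u where u: "loc_rep p 4 (diag e) (int p ^ (2 * u))" by blast
  \<comment> \<open>\<open>F\<close> bounds all the \<open>m i div 2\<close>, so the squares split
    off from the four coefficients can be brought to the common factor
    \<open>p^(2*F)\<close>.\<close>
  define F where "F = (\<Sum>i<4. m i div 2)"
  have F: "m i div 2 \<le> F" if "i < 4" for i
    unfolding F_def using that by (intro member_le_sum) auto
  have "loc_rep p 4 (diag d) (s * int p ^ (2 * (u + F)))"
    unfolding loc_rep_diag_iff
  proof
    fix k
    obtain x where x: "[(\<Sum>i<4. e i * (x i)\<^sup>2) = int p ^ (2 * u)] (mod int p ^ k)"
      using u unfolding loc_rep_diag_iff by blast
    have "\<exists>y. [s * d i * y\<^sup>2 = int p ^ m i * b i] (mod int p ^ k)" if "i < 4" for i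
      using unit_sq_class_sym[OF b(2)[OF that]] unfolding unit_sq_class_def by blast
    then obtain y where y: "\<And>i. i < 4 \<Longrightarrow> [s * d i * (y i)\<^sup>2 = int p ^ m i * b i] (mod int p ^ k)"
      by metis
    \<comment> \<open>The factor \<open>s\<close> turns \<open>d i\<close> into
      \<open>s * (s * d i)\<close>, \<open>y i\<close> moves \<open>s * d i\<close> to its
      representative, and the power of \<open>p\<close> fills up to \<open>p^(2*F)\<close>.\<close>
    define z where "z i = s * y i * x i * int p ^ (F - m i div 2)" for i
    have "[d i * (z i)\<^sup>2 = s * int p ^ (2 * F) * (e i * (x i)\<^sup>2)] (mod int p ^ k)" if i: "i < 4" for i
    proof -
      have "d i * (z i)\<^sup>2 = (s * (x i)\<^sup>2 * int p ^ (2 * (F - m i div 2))) * (s * d i * (y i)\<^sup>2)"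
        unfolding z_def by (simp add: power_mult_distrib power_mult power2_eq_square mult_2 power_add mult_ac)
      also have "[\<dots> = (s * (x i)\<^sup>2 * int p ^ (2 * (F - m i div 2))) * (int p ^ m i * b i)] (mod int p ^ k)"
        using y[OF i] by (rule cong_scalar_left)
      also have "(s * (x i)\<^sup>2 * int p ^ (2 * (F - m i div 2))) * (int p ^ m i * b i)
          = s * (x i)\<^sup>2 * b i * int p ^ (2 * (F - m i div 2) + m i)"
        by (simp add: power_add mult_ac)
      also have "2 * (F - m i div 2) + m i = 2 * F + m i mod 2" using F[OF i] by presburger
      also have "s * (x i)\<^sup>2 * b i * int p ^ (2 * F + m i mod 2) = s * int p ^ (2 * F) * (e i * (x i)\<^sup>2)"
        by (simp add: e_def power_add mult_ac)
      finally show ?thesis .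
    qed
    then have "[(\<Sum>i<4. d i * (z i)\<^sup>2) = (\<Sum>i<4. s * int p ^ (2 * F) * (e i * (x i)\<^sup>2))] (mod int p ^ k)"
      by (intro cong_sum) auto
    also have "(\<Sum>i<4. s * int p ^ (2 * F) * (e i * (x i)\<^sup>2)) = s * int p ^ (2 * F) * (\<Sum>i<4. e i * (x i)\<^sup>2)"
      by (simp add: sum_distrib_left)
    also have "[\<dots> = s * int p ^ (2 * F) * int p ^ (2 * u)] (mod int p ^ k)"
      using x by (rule cong_scalar_left)
    also have "s * int p ^ (2 * F) * int p ^ (2 * u) = s * int p ^ (2 * (u + F))"
      by (simp add: power_add algebra_simps)
    finally show "\<exists>z. [(\<Sum>i<4. d i * (z i)\<^sup>2) = s * int p ^ (2 * (u + F))] (mod int p ^ k)" by blast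
  qed
  then show ?thesis by blast
qed

section \<open>Local representations by lattices of rank at least 4\<close>

lemma orthogonal_vectors:
  assumes L: "zlattice n G" and "m \<le> n"
  shows "\<exists>v. (\<forall>i<m. v i \<in> vecs (Suc i) \<and> v i i \<noteq> 0) \<and>
    (\<forall>i<m. \<forall>j<m. i \<noteq> j \<longrightarrow> bform n G (v i) (v j) = 0)"
  using assms(2)
proof (induction m)
  case 0
  then show ?case by simp
next
  case (Suc m)
  then obtain v where v: "\<And>i. i < m \<Longrightarrow> v i \<in> vecs (Suc i)" "\<And>i. i < m \<Longrightarrow> v i i \<noteq> 0"
    and orth: "\<And>i j. i < m \<Longrightarrow> j < m \<Longrightarrow> i \<noteq> j \<Longrightarrow> bform n G (v i) (v j) = 0" by auto
  define e where "e = (\<lambda>l::nat. if l = m then 1 else 0::int)"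
  \<comment> \<open>Gram-Schmidt without denominators: the product \<open>P\<close> of the norms
    clears them. The triangular shape with nonzero diagonal keeps the vectors nonzero, hence
    \<open>P > 0\<close>.\<close>
  define P where "P = (\<Prod>i<m. qform n G (v i))"
  define c where "c i = - (P div qform n G (v i)) * bform n G e (v i)" for i
  define w where "w = (\<lambda>l. P * e l + (\<Sum>i<m. c i * v i l))"
  have Q: "qform n G (v i) > 0" if "i < m" for i
  proof -
    have "v i \<in> vecs n" using v(1)[OF that] that Suc.prems by (auto simp: vecs_def)
    moreover have "v i \<noteq> (\<lambda>_. 0)" using v(2)[OF that] by auto
    ultimately show ?thesis using L by (auto simp: zlattice_def)
  qed
  have "P > 0" unfolding P_def using Q by (intro prod_pos) auto
  have vm: "v i l = 0" if "i < m" "m \<le> l" for i l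
    using v(1)[OF that(1)] that by (auto simp: vecs_def)
  have w1: "w \<in> vecs (Suc m)" and w2: "w m \<noteq> 0"
    using vm \<open>P > 0\<close> by (auto simp: vecs_def w_def e_def)
  have wv: "bform n G w (v j) = 0" if j: "j < m" for j
  proof -
    have "bform n G w (v j) = P * bform n G e (v j) + (\<Sum>i<m. c i * bform n G (v i) (v j))"
      unfolding w_def by (simp add: bform_add_left bform_scale_left bform_sum_left)
    also have "(\<Sum>i<m. c i * bform n G (v i) (v j)) = (\<Sum>i\<in>{j}. c i * bform n G (v i) (v j))"
      using j orth by (intro sum.mono_neutral_right) auto
    also have "\<dots> = - (P div qform n G (v j) * qform n G (v j)) * bform n G e (v j)"
      by (simp add: c_def qform_def)
    also have "P div qform n G (v j) * qform n G (v j) = P"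
      using j unfolding P_def by (intro dvd_div_mult_self) (auto intro: dvd_prodI)
    finally show ?thesis by simp
  qed
  then have vw: "bform n G (v j) w = 0" if "j < m" for j
    using that bform_commute[OF L] by metis
  show ?case
    using v orth w1 w2 wv vw
    by (intro exI[of _ "v(m := w)"]) (auto simp: less_Suc_eq)
qed

text \<open>Without this, the \<open>LEAST\<close> in the definition of \<open>nu_s\<close> could range over an empty set.\<close>

lemma rank4_locally_universal:
  assumes L: "zlattice n G" and n: "n \<ge> 4" and p: "prime p" and s: "s \<noteq> 0"
  shows "\<exists>u. loc_rep p n G (s * int p ^ (2 * u))"
proof -
  obtain v where v: "\<And>i. i < 4 \<Longrightarrow> v i \<in> vecs (Suc i)" "\<And>i. i < 4 \<Longrightarrow> v i i \<noteq> 0"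
    and orth: "\<And>i j. i < 4 \<Longrightarrow> j < 4 \<Longrightarrow> i \<noteq> j \<Longrightarrow> bform n G (v i) (v j) = 0"
    using orthogonal_vectors[OF L n] by blast
  define d where "d i = qform n G (v i)" for i
  have vn: "v i \<in> vecs n" if "i < 4" for i
    using v(1)[OF that] that n by (auto simp: vecs_def)
  have "d i \<noteq> 0" if "i < 4" for i
    using qform_nonneg(2)[OF L vn[OF that]] v(2)[OF that] unfolding d_def by auto
  then obtain u where u: "loc_rep p 4 (diag d) (s * int p ^ (2 * u))"
    using quaternary_universal[OF p _ s] by blast
  have "loc_rep p n G (s * int p ^ (2 * u))"
    unfolding loc_rep_def
  proof
    fix k
    obtain x where x: "[(\<Sum>i<4. d i * (x i)\<^sup>2) = s * int p ^ (2 * u)] (mod int p ^ k)"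
      using u unfolding loc_rep_diag_iff by blast
    let ?w = "\<lambda>l. \<Sum>i<4. x i * v i l"
    have "qform n G ?w = (\<Sum>i<4. \<Sum>j<4. x i * x j * bform n G (v i) (v j))"
      unfolding qform_def by (rule bform_lincomb)
    also have "\<dots> = (\<Sum>i<4. \<Sum>j<4. if i = j then d i * (x i)\<^sup>2 else 0)"
      using orth by (intro sum.cong refl) (auto simp: d_def qform_def power2_eq_square)
    also have "\<dots> = (\<Sum>i<4. d i * (x i)\<^sup>2)" by simp
    finally have "[qform n G ?w = s * int p ^ (2 * u)] (mod int p ^ k)" using x by simp
    moreover have "?w \<in> vecs n" using vn by (intro vecs_sum) auto
    ultimately show "\<exists>x\<in>vecs n. [qform n G x = s * int p ^ (2 * u)] (mod int p ^ k)" by blast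
  qed
  then show ?thesis by blast
qed

text \<open>Outside \<open>Aset\<close> the invariant \<open>nu\<close> is at most 1, while the
  order of \<open>s * p^(2*u)\<close> is at least \<open>2 * u\<close>. So \<open>u = 0\<close>:
  each element of \<open>SC p\<close> is itself represented, and with it its square
  multiples.\<close>

lemma loc_rep_outside_Aset:
  assumes L: "zlattice n G" "n \<ge> 4" "primitive n G" "regular n G"
    and p: "prime p" "p \<notin> Aset" and a: "a \<noteq> 0"
  shows "loc_rep p n G a"
proof -
  let ?m = "multiplicity (int p) a"
  obtain b where b: "b \<in> unit_reps p" "unit_sq_class p (int p ^ ?m * b) a"
    using class_rep[OF p(1) a] by blast
  define s where "s = int p ^ (?m mod 2) * b"
  have s: "s \<in> SC p" unfolding s_def by (rule SC_reps[OF b(1)])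
  have pp: "prime (int p)" using p(1) by simp
  have "b \<noteq> 0"
    using unit_reps_coprime[OF p(1) b(1)] pp by auto
  then have s0: "s \<noteq> 0" using p(1) unfolding s_def by auto
  define u where "u = (LEAST u. loc_rep p n G (s * int p ^ (2 * u)))"
  have u: "loc_rep p n G (s * int p ^ (2 * u))"
    unfolding u_def using rank4_locally_universal[OF L(1,2) p(1) s0] by (rule LeastI_ex)
  have "nu p n G \<le> 1"
    using L p unfolding Aset_def by (metis (mono_tags, lifting) mem_Collect_eq not_le)
  moreover have "nu_s p n G s \<le> nu p n G"
    unfolding nu_def using s by (intro Max_ge) (auto simp: SC_def)
  moreover have "2 * u \<le> nu_s p n G s"
    unfolding nu_s_def u_def[symmetric] using s0 pp
    by (intro multiplicity_geI) auto
  ultimately have "u = 0" by simp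
  then have "loc_rep p n G s" using u by simp
  then have "loc_rep p n G ((int p ^ (?m div 2))\<^sup>2 * s)" by (rule loc_rep_square_mult)
  also have "(int p ^ (?m div 2))\<^sup>2 * s = int p ^ (?m div 2 * 2 + ?m mod 2) * b"
    unfolding s_def power_add power_mult by simp
  finally have "loc_rep p n G (int p ^ ?m * b)" by simp
  then show ?thesis using b(2) loc_rep_cong_class by blast
qed

text \<open>Otherwise the quadratic polynomial \<open>Q(\<alpha>x + y)\<close> in \<open>\<alpha>\<close>, after division by the exact power of
  \<open>p\<close> in \<open>2B(x,y)\<close>, has unit derivative and hence takes the value \<open>\<tau>\<close> over \<open>\<int>\<^sub>p\<close>.\<close>

lemma bform_dvd_if_not_loc_rep:
  assumes L: "zlattice n G" and xy: "x \<in> vecs n" "y \<in> vecs n" and p: "prime p"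
    and tau: "int p ^ (2 * k) dvd \<tau>" "\<not> loc_rep p n G \<tau>"
    and Qx: "int p ^ Suc (2 * k) dvd qform n G x" and Qy: "int p ^ (2 * k) dvd qform n G y"
  shows "int p ^ (2 * k) dvd bform n G x y"
proof (rule ccontr)
  let ?B = "bform n G x y"
  assume nd: "\<not> int p ^ (2 * k) dvd ?B"
  have pp: "prime (int p)" using p by simp
  then have nu: "\<not> is_unit (int p)" by (meson not_prime_unit)
  have B0: "2 * ?B \<noteq> 0" using nd by auto
  define j where "j = multiplicity (int p) (2 * ?B)"
  obtain w where w: "2 * ?B = int p ^ j * w" "\<not> int p dvd w"
    unfolding j_def using multiplicity_decompose'[OF B0 nu] by metis
  have cw: "coprime w (int p)" using w(2) pp prime_imp_coprime[of "int p" w] by (auto simp: coprime_commute)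
  \<comment> \<open>The factor 2 adds one power of \<open>p\<close> for \<open>p = 2\<close> and
    none for odd \<open>p\<close>.\<close>
  have "\<not> int p ^ Suc (2 * k) dvd 2 * ?B"
  proof
    assume *: "int p ^ Suc (2 * k) dvd 2 * ?B"
    show False
    proof (cases "p = 2")
      case True
      then show ?thesis using * nd by simp
    next
      case False
      then have "odd p" using p odd_prime_if_not_2 by blast
      then have "coprime (int p ^ (2 * k)) 2" by simp
      moreover have "int p ^ (2 * k) dvd 2 * ?B" using * dvd_trans le_imp_power_dvd by (metis lessI less_imp_le_nat)
      ultimately show ?thesis using nd coprime_dvd_mult_right_iff by blast
    qed
  qed
  then have j: "j \<le> 2 * k"
    using multiplicity_dvd[of "int p" "2 * ?B"] unfolding j_def
    by (metis dvd_trans le_imp_power_dvd not_less_eq_eq)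
  \<comment> \<open>The extra power of \<open>p\<close> in \<open>Q(x)\<close> leaves, after
    division by \<open>p^j\<close>, a polynomial that is linear modulo \<open>p\<close> with the
    unit \<open>w\<close> as slope.\<close>
  obtain a where a: "qform n G x = int p ^ j * (int p * a)"
  proof -
    have "int p ^ Suc j dvd qform n G x" using Qx j by (meson dvd_trans le_imp_power_dvd Suc_le_mono)
    then obtain t where "qform n G x = int p ^ Suc j * t" by (elim dvdE)
    then show ?thesis using that[of t] by (simp add: mult_ac)
  qed
  obtain c where c: "qform n G y - \<tau> = int p ^ j * c"
  proof -
    have "int p ^ j dvd int p ^ (2 * k)" using j by (rule le_imp_power_dvd)
    then have "int p ^ j dvd qform n G y - \<tau>" using Qy tau(1) by (meson dvd_trans dvd_diff)
    then show ?thesis using that by (elim dvdE)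
  qed
  have "loc_rep p n G \<tau>"
    unfolding loc_rep_def
  proof
    fix m
    obtain z where z: "[w * z = 1] (mod int p)" using cw cong_solve_coprime_int by blast
    define \<alpha> where "\<alpha> = - (z * c)"
    have "[(int p * a) * \<alpha>\<^sup>2 + w * \<alpha> + c = 0] (mod int p ^ (2 * 0 + 1))"
    proof -
      have e: "(int p * a) * \<alpha>\<^sup>2 + w * \<alpha> + c = int p * (a * \<alpha>\<^sup>2) - (w * z - 1) * c"
        unfolding \<alpha>_def by (simp add: algebra_simps)
      have "int p dvd w * z - 1" using z by (simp add: cong_iff_dvd_diff)
      then have "int p dvd int p * (a * \<alpha>\<^sup>2) - (w * z - 1) * c" by (intro dvd_diff) auto
      then show ?thesis unfolding e by (simp add: cong_0_iff)
    qed
    moreover have "coprime (2 * (int p * a) * \<alpha> + w) (int p)"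
    proof -
      have "[w = 2 * (int p * a) * \<alpha> + w] (mod int p)" by (simp add: cong_iff_dvd_diff)
      then show ?thesis using cw cong_imp_coprime by blast
    qed
    ultimately obtain \<beta> where \<beta>: "[(int p * a) * \<beta>\<^sup>2 + w * \<beta> + c = 0] (mod int p ^ m)"
      using hensel_quadratic[OF p, of "int p * a" \<alpha> w c 0 "2 * (int p * a) * \<alpha> + w" m] by auto
    have "qform n G (\<lambda>i. \<beta> * x i + y i) - \<tau> = int p ^ j * ((int p * a) * \<beta>\<^sup>2 + w * \<beta> + c)"
    proof -
      have "qform n G (\<lambda>i. \<beta> * x i + y i) - \<tau>
          = qform n G x * \<beta>\<^sup>2 + 2 * ?B * \<beta> + (qform n G y - \<tau>)"
        by (simp add: qform_lincomb2[OF L])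
      then show ?thesis unfolding a w(1) c by (simp add: algebra_simps)
    qed
    then have "[qform n G (\<lambda>i. \<beta> * x i + y i) = \<tau>] (mod int p ^ m)"
      using \<beta> by (simp add: cong_iff_dvd_diff)
    then show "\<exists>x\<in>vecs n. [qform n G x = \<tau>] (mod int p ^ m)"
      using xy vecs_add[OF vecs_scale] by blast
  qed
  then show False using tau(2) by simp
qed

subsection \<open>Sublattices\<close>

text \<open>Induction on the dimension: a vector whose last coordinate is the least positive one in
  \<open>M\<close> completes a basis of the part of \<open>M\<close> with last coordinate
  zero.\<close>

lemma sublattice_basis:
  assumes "sublattice n M"
  shows "\<exists>r b. (\<forall>i<r. b i \<in> M) \<and> (\<forall>x\<in>M. \<exists>c\<in>vecs r. x = (\<lambda>l. \<Sum>i<r. c i * b i l)) \<and>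
    (\<forall>c\<in>vecs r. (\<lambda>l. \<Sum>i<r. c i * b i l) = (\<lambda>_. 0) \<longrightarrow> c = (\<lambda>_. 0))"
  using assms
proof (induction n arbitrary: M)
  case 0
  then have "M = {\<lambda>_. 0}" by (auto simp: sublattice_def vecs_def)
  then show ?case by (intro exI[of _ 0]) (auto simp: vecs_def)
next
  case (Suc n)
  note M = Suc.prems
  have Madd: "(\<lambda>l. x l + y l) \<in> M" if "x \<in> M" "y \<in> M" for x y
    using M that by (auto simp: sublattice_def)
  have Mscale: "(\<lambda>l. c * x l) \<in> M" if "x \<in> M" for x c
    using M that by (auto simp: sublattice_def)
  have Mvecs: "x l = 0" if "x \<in> M" "l \<ge> Suc n" for x l
    using M that unfolding sublattice_def vecs_def by blast
  have sub: "sublattice n (M \<inter> vecs n)"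
    using M by (auto simp: sublattice_def vecs_def)
  obtain r b where h: "\<forall>i<r. b i \<in> M \<inter> vecs n"
      "\<forall>x\<in>M \<inter> vecs n. \<exists>c\<in>vecs r. x = (\<lambda>l. \<Sum>i<r. c i * b i l)"
      "\<forall>c\<in>vecs r. (\<lambda>l. \<Sum>i<r. c i * b i l) = (\<lambda>_. 0) \<longrightarrow> c = (\<lambda>_. 0)"
    using Suc.IH[OF sub] by (elim exE conjE) (rule that)
  have b: "\<And>i. i < r \<Longrightarrow> b i \<in> M" "\<And>i. i < r \<Longrightarrow> b i \<in> vecs n"
    using h(1) by auto
  have span: "\<And>x. x \<in> M \<Longrightarrow> x \<in> vecs n \<Longrightarrow> \<exists>c\<in>vecs r. x = (\<lambda>l. \<Sum>i<r. c i * b i l)"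
    using h(2) by simp
  have ind: "\<And>c. c \<in> vecs r \<Longrightarrow> (\<lambda>l. \<Sum>i<r. c i * b i l) = (\<lambda>_. 0) \<Longrightarrow> c = (\<lambda>_. 0)"
    using h(3) by simp
  have down: "x \<in> vecs n" if "x \<in> M" "x n = 0" for x
    using Mvecs[OF that(1)] that(2) by (auto simp: vecs_def) (metis le_eq_less_or_eq Suc_leI)
  show ?case
  proof (cases "\<forall>x\<in>M. x n = 0")
    case True
    then have "\<exists>c\<in>vecs r. x = (\<lambda>l. \<Sum>i<r. c i * b i l)" if "x \<in> M" for x
      using span that down by blast
    then show ?thesis using b(1) ind by (intro exI[of _ r] exI[of _ b]) blast
  next
    case False
    define P where "P d \<longleftrightarrow> d > 0 \<and> (\<exists>x\<in>M. x n = int d)" for d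
    have "\<exists>d. P d"
    proof -
      obtain x where x: "x \<in> M" "x n \<noteq> 0" using False by blast
      \<comment> \<open>Multiplication by the sign makes the last coordinate positive.\<close>
      have "P (nat (sgn (x n) * x n))"
        using x Mscale[OF x(1), of "sgn (x n)"] unfolding P_def
        by (auto simp: sgn_if intro!: bexI[of _ "\<lambda>l. sgn (x n) * x l"])
      then show ?thesis by blast
    qed
    then have Pd: "P (LEAST d. P d)" by (rule LeastI_ex)
    define d where "d = (LEAST d. P d)"
    obtain y where y: "y \<in> M" "y n = int d" and d0: "d > 0" using Pd unfolding d_def P_def by blast
    define b' where "b' = b(r := y)"
    have expand: "(\<lambda>l. \<Sum>i<Suc r. c i * b' i l) = (\<lambda>l. (\<Sum>i<r. c i * b i l) + c r * y l)" for c
      by (simp add: b'_def)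
    have "\<exists>c\<in>vecs (Suc r). x = (\<lambda>l. \<Sum>i<Suc r. c i * b' i l)" if x: "x \<in> M" for x
    proof -
      define q where "q = x n div int d"
      define z where "z = (\<lambda>l. x l + (- q) * y l)"
      have zM: "z \<in> M" unfolding z_def using Madd[OF x Mscale[OF y(1)]] .
      have zn: "z n = x n mod int d" unfolding z_def q_def y(2) by (simp add: minus_div_mult_eq_mod)
      \<comment> \<open>\<open>z n\<close> is a remainder modulo the least positive last coordinate
        \<open>d\<close>, and \<open>z\<close> is again in \<open>M\<close>.\<close>
      have "z n = 0"
      proof (rule ccontr)
        assume "z n \<noteq> 0"
        then have "P (nat (z n))" "nat (z n) < d"
          using zM d0 unfolding P_def zn by (auto intro!: bexI[of _ z] simp: zn nat_less_iff
              order_le_neq_trans[OF pos_mod_sign])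
        then show False unfolding d_def using not_less_Least by blast
      qed
      then obtain c where c: "c \<in> vecs r" "z = (\<lambda>l. \<Sum>i<r. c i * b i l)"
        using span[OF zM down[OF zM]] by blast
      have xz: "x = (\<lambda>l. z l + q * y l)" by (simp add: z_def)
      have "x = (\<lambda>l. \<Sum>i<Suc r. (c(r := q)) i * b' i l)"
        unfolding expand by (subst xz, subst c(2)) simp
      moreover have "c(r := q) \<in> vecs (Suc r)" using c(1) by (auto simp: vecs_def)
      ultimately show ?thesis by blast
    qed
    moreover have "c = (\<lambda>_. 0)"
      if c: "c \<in> vecs (Suc r)" "(\<lambda>l. \<Sum>i<Suc r. c i * b' i l) = (\<lambda>_. 0)" for c
    proof -
      note e = c(2)[unfolded expand]
      have "(\<Sum>i<r. c i * b i n) = 0" using b(2) by (intro sum.neutral) (auto simp: vecs_def)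
      then have cr: "c r = 0" using fun_cong[OF e, of n] y(2) d0 by simp
      then have "c \<in> vecs r" using c(1) by (auto simp: vecs_def) (metis le_eq_less_or_eq Suc_leI)
      then show ?thesis using ind e cr by simp
    qed
    moreover have "b' i \<in> M" if "i < Suc r" for i
      using that b(1) y(1) by (auto simp: b'_def less_Suc_eq)
    ultimately show ?thesis by (intro exI[of _ "Suc r"] exI[of _ b']) blast
  qed
qed

text \<open>The Gram matrix of a basis of \<open>N\<close>, divided by \<open>D\<close>, is an
  integral lattice to which the criterion applies. Independence of the basis makes it positive
  definite.\<close>

lemma sublattice_scaled_represents:
  assumes L: "zlattice n G" and N: "sublattice n N" and D: "D > 0"
    and dvd: "\<And>x y. x \<in> N \<Longrightarrow> y \<in> N \<Longrightarrow> D dvd bform n G x y"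
    and crit: "univ_criterion S T"
    and T: "\<And>t. t \<in> T \<Longrightarrow> \<exists>x\<in>N. qform n G x = D * t"
    and s: "s \<in> S"
  shows "\<exists>x\<in>N. qform n G x = D * s"
proof -
  obtain r b where h: "\<forall>i<r. b i \<in> N"
      "\<forall>x\<in>N. \<exists>c\<in>vecs r. x = (\<lambda>l. \<Sum>i<r. c i * b i l)"
      "\<forall>c\<in>vecs r. (\<lambda>l. \<Sum>i<r. c i * b i l) = (\<lambda>_. 0) \<longrightarrow> c = (\<lambda>_. 0)"
    using sublattice_basis[OF N] by (elim exE conjE) (rule that)
  have b: "\<And>i. i < r \<Longrightarrow> b i \<in> N" using h(1) by auto
  have span: "\<And>x. x \<in> N \<Longrightarrow> \<exists>c\<in>vecs r. x = (\<lambda>l. \<Sum>i<r. c i * b i l)"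
    using h(2) by simp
  have ind: "\<And>c. c \<in> vecs r \<Longrightarrow> (\<lambda>l. \<Sum>i<r. c i * b i l) = (\<lambda>_. 0) \<Longrightarrow> c = (\<lambda>_. 0)"
    using h(3) by simp
  define H where "H i j = bform n G (b i) (b j) div D" for i j
  define comb where "comb c = (\<lambda>l. \<Sum>i<r. c i * b i l)" for c
  have Nsum: "(\<lambda>l. \<Sum>i<m. c i * b i l) \<in> N" if "m \<le> r" for c m
    using that
  proof (induction m)
    case 0
    then show ?case using N by (simp add: sublattice_def)
  next
    case (Suc m)
    then show ?case using N b[of m] unfolding sublattice_def by simp
  qed
  then have combN: "comb c \<in> N" for c unfolding comb_def by simp
  have Q: "D * qform r H c = qform n G (comb c)" for c
  proof -
    have "D * qform r H c = (\<Sum>i<r. \<Sum>j<r. c i * c j * (D * H i j))"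
      unfolding qform_def bform_def by (simp add: sum_distrib_left mult_ac)
    also have "\<dots> = (\<Sum>i<r. \<Sum>j<r. c i * c j * bform n G (b i) (b j))"
      using dvd b by (intro sum.cong refl) (simp add: H_def)
    also have "\<dots> = qform n G (comb c)" unfolding qform_def comb_def by (rule bform_lincomb[symmetric])
    finally show ?thesis .
  qed
  have "zlattice r H"
    unfolding zlattice_def
  proof (intro conjI allI impI ballI)
    show "H i j = H j i" for i j unfolding H_def using bform_commute[OF L] by metis
    fix c assume c: "c \<in> vecs r" "c \<noteq> (\<lambda>_. 0)"
    then have "comb c \<noteq> (\<lambda>_. 0)" using ind unfolding comb_def by blast
    moreover have "comb c \<in> vecs n" using combN N by (auto simp: sublattice_def)
    ultimately have "D * qform r H c > 0" unfolding Q using L by (simp add: zlattice_def)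
    then show "qform r H c > 0" using D by (simp add: zero_less_mult_iff)
  qed
  moreover have "T \<subseteq> qvals r H"
  proof
    fix t assume "t \<in> T"
    then obtain x where x: "x \<in> N" "qform n G x = D * t" using T by blast
    obtain c where c: "c \<in> vecs r" "x = comb c" using span[OF x(1)] unfolding comb_def by blast
    then have "D * qform r H c = D * t" using Q x by simp
    then show "t \<in> qvals r H" using c(1) D unfolding qvals_def by force
  qed
  ultimately have "S \<subseteq> qvals r H" using crit by (simp add: univ_criterion_def)
  then obtain c where "qform r H c = s" using s unfolding qvals_def by blast
  then show ?thesis using Q[of c] combN by metis
qed

section \<open>Integer spans of finite sets of vectors\<close>

definition zspan :: "(nat \<Rightarrow> int) set \<Rightarrow> (nat \<Rightarrow> int) set" where
  "zspan X = range (\<lambda>c l. \<Sum>v\<in>X. c v * v l)"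

lemma zspan_base:
  assumes "finite X" "v \<in> X"
  shows "v \<in> zspan X"
proof -
  have "(\<Sum>u\<in>X. (if u = v then 1 else 0) * u l) = v l" for l
  proof -
    have "(\<Sum>u\<in>X. (if u = v then 1 else 0) * u l) = (\<Sum>u\<in>X. if u = v then u l else 0)"
      by (intro sum.cong) auto
    then show ?thesis using assms by simp
  qed
  then show ?thesis unfolding zspan_def
    by (intro image_eqI[where x = "\<lambda>u. if u = v then 1 else 0"]) auto
qed

lemma zspan_sublattice:
  assumes "X \<subseteq> vecs n"
  shows "sublattice n (zspan X)"
  unfolding sublattice_def
proof (intro conjI ballI allI)
  show "zspan X \<subseteq> vecs n" using assms unfolding zspan_def
    by (auto intro!: vecs_sum)
  show "(\<lambda>_. 0) \<in> zspan X" unfolding zspan_def by (intro image_eqI[where x = "\<lambda>_. 0"]) auto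
  fix x assume "x \<in> zspan X"
  then obtain c where c: "x = (\<lambda>l. \<Sum>v\<in>X. c v * v l)" unfolding zspan_def by blast
  show "(\<lambda>i. a * x i) \<in> zspan X" for a
    unfolding zspan_def c
    by (intro image_eqI[where x = "\<lambda>v. a * c v"]) (auto simp: sum_distrib_left mult_ac)
  fix y assume "y \<in> zspan X"
  then obtain d where d: "y = (\<lambda>l. \<Sum>v\<in>X. d v * v l)" unfolding zspan_def by blast
  show "(\<lambda>i. x i + y i) \<in> zspan X"
    unfolding zspan_def c d
    by (intro image_eqI[where x = "\<lambda>v. c v + d v"]) (auto simp: sum.distrib algebra_simps)
qed

lemma zspan_mono:
  assumes "finite Y" "X \<subseteq> Y"
  shows "zspan X \<subseteq> zspan Y"
proof
  fix x assume "x \<in> zspan X"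
  then obtain c where c: "x = (\<lambda>l. \<Sum>v\<in>X. c v * v l)" unfolding zspan_def by blast
  have "(\<Sum>v\<in>X. c v * v l) = (\<Sum>v\<in>Y. (if v \<in> X then c v else 0) * v l)" for l
    using assms by (intro sum.mono_neutral_cong_left) auto
  then show "x \<in> zspan Y" unfolding zspan_def c
    by (intro image_eqI[where x = "\<lambda>v. if v \<in> X then c v else 0"]) auto
qed

lemma zspan_bform_dvd:
  assumes "\<And>x y. x \<in> X \<Longrightarrow> y \<in> X \<Longrightarrow> D dvd bform n G x y" "x \<in> zspan X" "y \<in> zspan X"
  shows "D dvd bform n G x y"
proof -
  obtain c where c: "x = (\<lambda>l. \<Sum>v\<in>X. c v * v l)" using assms(2) unfolding zspan_def by blast
  obtain d where d: "y = (\<lambda>l. \<Sum>v\<in>X. d v * v l)" using assms(3) unfolding zspan_def by blast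
  have "bform n G x y = (\<Sum>v\<in>X. \<Sum>w\<in>X. c v * d w * bform n G v w)"
    unfolding c d by (rule bform_lincomb)
  then show ?thesis using assms(1) by (auto intro!: dvd_sum dvd_mult)
qed

text \<open>Reduction modulo 2 turns a generating set of \<open>\<int>\<^sup>n\<close> with \<open>m\<close> elements into a surjection
  from a set with \<open>2\<^sup>m\<close> elements onto one with \<open>2\<^sup>n\<close> elements.\<close>

lemma rank_le_card_generators:
  assumes X: "finite X" "vecs n \<subseteq> zspan X"
  shows "n \<le> card X"
proof -
  let ?A = "PiE X (\<lambda>_. {0, 1::int})" and ?B = "PiE {..<n} (\<lambda>_. {0, 1::int})"
  let ?f = "\<lambda>c. restrict (\<lambda>l. (\<Sum>v\<in>X. c v * v l) mod 2) {..<n}"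
  have "?B \<subseteq> ?f ` ?A"
  proof
    fix e assume e: "e \<in> ?B"
    let ?e = "\<lambda>l. if l < n then e l else 0"
    have "?e \<in> vecs n" by (simp add: vecs_def)
    then obtain c where c: "?e = (\<lambda>l. \<Sum>v\<in>X. c v * v l)" using X(2) unfolding zspan_def by blast
    let ?c = "restrict (\<lambda>v. c v mod 2) X"
    have cA: "?c \<in> ?A" by auto
    have fc: "?f ?c = e"
    proof
      fix l show "?f ?c l = e l"
      proof (cases "l < n")
        case True
        have "(\<Sum>v\<in>X. ?c v * v l) mod 2 = (\<Sum>v\<in>X. (c v mod 2) * v l) mod 2"
          by (intro arg_cong[where f = "\<lambda>t. t mod 2"] sum.cong) auto
        also have "\<dots> = (\<Sum>v\<in>X. c v * v l) mod 2"
        proof -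
          have "[(\<Sum>v\<in>X. (c v mod 2) * v l) = (\<Sum>v\<in>X. c v * v l)] (mod 2)"
            by (intro cong_sum cong_mult cong_refl) (simp add: cong_def)
          then show ?thesis by (simp add: cong_def)
        qed
        also have "\<dots> = e l mod 2" using fun_cong[OF c, of l] True by simp
        also have "\<dots> = e l"
        proof -
          have "e l \<in> {0, 1}" using e True by (auto simp: PiE_def Pi_def)
          then show ?thesis by auto
        qed
        finally show ?thesis using True by simp
      next
        case False
        then show ?thesis using e by (auto simp: PiE_def extensional_def)
      qed
    qed
    show "e \<in> ?f ` ?A" using imageI[OF cA, of ?f] unfolding fc .
  qed
  then have "card ?B \<le> card (?f ` ?A)" using X(1) by (intro card_mono finite_imageI finite_PiE) auto
  also have "\<dots> \<le> card ?A" using X(1) by (intro card_image_le finite_PiE) auto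
  finally have "(2::nat) ^ n \<le> 2 ^ card X" using X(1) by (simp add: card_PiE numeral_eq_Suc)
  then show ?thesis by simp
qed

subsection \<open>A lower bound for the sum of the sizes of the criterion sets\<close>

lemma Bp_reps: "Bp nub p = {int p ^ c * b | c b. c \<le> nub p + 3 \<and> b \<in> unit_reps p}"
  by (simp add: Bp_def unit_reps_def)

lemma finite_Bp: "finite (Bp nub p)"
proof -
  have "Bp nub p = (\<lambda>(c, b). int p ^ c * b) ` ({..nub p + 3} \<times> unit_reps p)"
    unfolding Bp_reps by auto
  moreover have "finite (unit_reps p)" by (simp add: unit_reps_def)
  ultimately show ?thesis by simp
qed

lemma Aset_prime: "p \<in> Aset \<Longrightarrow> prime p"
  by (simp add: Aset_def)

lemma unit_sq_class_dvd:
  assumes "unit_sq_class p e m" "int p ^ k dvd e"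
  shows "int p ^ k dvd m"
proof -
  obtain x where "[e * x\<^sup>2 = m] (mod int p ^ k)" using assms(1) unfolding unit_sq_class_def by blast
  moreover have "int p ^ k dvd e * x\<^sup>2" using assms(2) by simp
  ultimately show ?thesis using cong_dvd_iff by blast
qed

lemma card_Bp_ge:
  assumes "prime p"
  shows "card (Bp nub p) \<ge> 3"
proof -
  have "inj_on (\<lambda>c. int p ^ c) {0, 1, 2::nat}"
    using power_inject_exp[of "int p"] prime_gt_1_nat[OF assms] by (intro inj_onI) simp
  then have "card ((\<lambda>c. int p ^ c) ` {0, 1, 2::nat}) = 3" by (simp add: card_image)
  moreover have "(\<lambda>c. int p ^ c) ` {0, 1, 2::nat} \<subseteq> Bp nub p"
  proof
    fix z assume "z \<in> (\<lambda>c. int p ^ c) ` {0, 1, 2::nat}"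
    then obtain c where c: "c \<in> {0, 1, 2::nat}" "z = int p ^ c" by blast
    have "z = int p ^ c * 1" using c(2) by simp
    moreover have "1 \<in> unit_reps p" by (simp add: unit_reps_def)
    moreover have "c \<le> nub p + 3" using c(1) by auto
    ultimately show "z \<in> Bp nub p" unfolding Bp_reps by blast
  qed
  ultimately show ?thesis using card_mono[OF finite_Bp] by metis
qed

text \<open>Three digits beyond \<open>p^c\<close> determine the square class: they give the unit
  part modulo 8 for \<open>p = 2\<close>, and in particular modulo \<open>p\<close> for odd
  \<open>p\<close>.\<close>

lemma unit_sq_class_near:
  assumes p: "prime p" and b: "coprime b (int p)"
    and m: "[m = int p ^ c * b] (mod int p ^ (c + 3))"
  shows "unit_sq_class p (int p ^ c * b) m"
proof -
  obtain q where q: "m - int p ^ c * b = int p ^ (c + 3) * q"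
    using m by (auto simp: cong_iff_dvd_diff)
  define r where "r = b + int p ^ 3 * q"
  have mr: "m = int p ^ c * r" using q unfolding r_def by (simp add: algebra_simps power_add)
  have "unit_sq_class p b r"
  proof (cases "p = 2")
    case True
    then show ?thesis using b unfolding r_def
      by (auto intro!: unit_sq_class_two simp: cong_iff_dvd_diff)
  next
    case False
    then have "odd p" using p odd_prime_if_not_2 by blast
    moreover have br: "[b = r] (mod int p)" unfolding r_def by (simp add: cong_iff_dvd_diff power3_eq_cube)
    moreover have "coprime r (int p)" using b br cong_imp_coprime by blast
    ultimately show ?thesis using p b by (intro unit_sq_class_odd[of _ _ 1]) auto
  qed
  then show ?thesis unfolding mr by (rule unit_sq_class_mult)
qed

lemma S_eta_nonempty:
  assumes fin: "finite Aset" and eta: "eta \<in> Bset nub"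
  shows "S_eta eta \<noteq> {}"
proof -
  have "\<exists>c b. b \<in> unit_reps p \<and> eta p = int p ^ c * b" if "p \<in> Aset" for p
    using eta that unfolding Bset_def Bp_reps by (auto dest!: PiE_mem)
  then obtain c b where cb: "\<And>p. p \<in> Aset \<Longrightarrow> b p \<in> unit_reps p"
      "\<And>p. p \<in> Aset \<Longrightarrow> eta p = int p ^ c p * b p" by metis
  define M where "M p = p ^ (c p + 3)" for p
  have cop: "coprime (M p) (M q)" if "p \<in> Aset" "q \<in> Aset" "p \<noteq> q" for p q
    unfolding M_def using that Aset_prime by (auto simp: primes_coprime)
  have Mpos: "M p > 0" if "p \<in> Aset" for p
    using Aset_prime[OF that] unfolding M_def by (simp add: prime_gt_0_nat)
  obtain x where x: "\<And>p. p \<in> Aset \<Longrightarrow> [x = nat (eta p mod int (M p))] (mod M p)"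
    using chinese_remainder_nat[of Aset M "\<lambda>p. nat (eta p mod int (M p))"] fin cop by blast
  define P where "P = (\<Prod>p\<in>Aset. M p)"
  have Ppos: "P > 0" unfolding P_def using Mpos by (simp add: prod_pos)
  \<comment> \<open>Adding the product of the moduli gives a positive number in the same residue
    classes.\<close>
  have "int (x + P) \<in> S_eta eta"
    unfolding S_eta_def
  proof (intro CollectI conjI ballI)
    show "int (x + P) > 0" using Ppos by simp
    fix p assume p: "p \<in> Aset"
    have "M p dvd P" unfolding P_def using fin p by (rule dvd_prodI)
    then have "[x + P = x] (mod M p)" by (simp add: cong_def mod_add_eq[symmetric, of x P])
    then have "[x + P = nat (eta p mod int (M p))] (mod M p)" using x[OF p] cong_trans by blast
    then have "[int (x + P) = int (nat (eta p mod int (M p)))] (mod int (M p))"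
      by (simp only: cong_int_iff)
    also have "int (nat (eta p mod int (M p))) = eta p mod int (M p)" using Mpos[OF p] by simp
    also have "[\<dots> = eta p] (mod int (M p))" by (simp add: cong_def)
    finally show "unit_sq_class p (eta p) (int (x + P))"
      unfolding cb(2)[OF p] M_def using Aset_prime[OF p] unit_reps_coprime cb(1)[OF p]
      by (intro unit_sq_class_near) auto
  qed
  then show ?thesis by blast
qed

text \<open>The lattice of rank 0 represents all elements of the empty set, but no positive
  integer.\<close>

lemma criterion_card_pos:
  assumes "univ_criterion S T" "S \<noteq> {}" "S \<subseteq> {0<..}"
  shows "card T > 0"
proof (rule ccontr)
  assume "\<not> card T > 0"
  then have "T = {}" using assms(1) by (auto simp: univ_criterion_def)
  moreover have "zlattice 0 (\<lambda>_ _. 0)" by (auto simp: zlattice_def vecs_def)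
  ultimately have "S \<subseteq> qvals 0 (\<lambda>_ _. 0)" using assms(1) by (auto simp: univ_criterion_def)
  then have "S \<subseteq> {0}" by (auto simp: qvals_def qform_def bform_def)
  then show False using assms(2,3) by auto
qed

section \<open>Criterion sets for all positive integers\<close>

lemma zlattice_diag:
  assumes "\<And>i. i < n \<Longrightarrow> d i > 0"
  shows "zlattice n (diag d)"
  unfolding zlattice_def
proof (intro conjI allI impI ballI)
  show "diag d i j = diag d j i" for i j by (simp add: diag_def)
  fix x assume x: "x \<in> vecs n" "x \<noteq> (\<lambda>_. 0)"
  then obtain i where i: "i < n" "x i \<noteq> 0" by (auto simp: vecs_def fun_eq_iff) (metis not_le)
  then have "0 < d i * (x i)\<^sup>2" using assms by simp
  also have "\<dots> \<le> (\<Sum>i<n. d i * (x i)\<^sup>2)"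
    using i assms by (intro member_le_sum) (auto simp: less_imp_le)
  finally show "qform n (diag d) x > 0" by (simp add: qform_diag)
qed

text \<open>The value 1 forces a coefficient 1, the value 2 then bounds the other one by 2, and
  squares modulo 8 show that \<open>x^2 + y^2\<close> misses 3 and \<open>x^2 + 2 * y^2\<close>
  misses 5.\<close>

lemma binary_diag_not_universal:
  fixes s t :: int
  assumes "s > 0" "t > 0" and univ: "\<And>a. a > 0 \<Longrightarrow> \<exists>x y. s * x\<^sup>2 + t * y\<^sup>2 = (a::int)"
  shows False
proof -
  have bound: False if t: "t > 0" and univ: "\<And>a. a > 0 \<Longrightarrow> \<exists>x y. x\<^sup>2 + t * y\<^sup>2 = (a::int)" for t :: int
  proof -
    obtain x y :: int where xy: "x\<^sup>2 + t * y\<^sup>2 = 2" using univ[of 2] by auto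
    have "y \<noteq> 0"
    proof
      assume "y = 0"
      then have x2: "x * x = 2" using xy by (simp add: power2_eq_square)
      then have "even (x * x)" by simp
      then obtain z where "x = 2 * z" by (auto elim: evenE)
      then show False using x2 by (simp; presburger)
    qed
    then have "y\<^sup>2 \<ge> 1" by (simp add: int_one_le_iff_zero_less)
    then have "t \<le> t * y\<^sup>2" using t by (simp add: mult_le_cancel_left1)
    then have "t \<le> 2" using xy zero_le_power2[of x] by linarith
    have sq: "z\<^sup>2 mod 8 \<in> {0, 1, 4}" for z :: int
    proof -
      have "z mod 8 \<in> {0..<8}" by simp
      then have "z mod 8 \<in> {0, 1, 2, 3, 4, 5, 6, 7}" by (auto simp: atLeastLessThan_def)
      then have "(z mod 8)\<^sup>2 mod 8 \<in> {0, 1, 4}" by auto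
      then show ?thesis by (simp add: power_mod)
    qed
    consider "t = 1" | "t = 2" using t \<open>t \<le> 2\<close> by linarith
    then show False
    proof cases
      case 1
      obtain x y :: int where "x\<^sup>2 + t * y\<^sup>2 = 3" using univ[of 3] by auto
      then have "(x\<^sup>2 mod 8 + y\<^sup>2 mod 8) mod 8 = 3" using 1 by (simp add: mod_add_eq)
      then show False using sq[of x] sq[of y] by auto
    next
      case 2
      obtain x y :: int where "x\<^sup>2 + t * y\<^sup>2 = 5" using univ[of 5] by auto
      then have e: "x\<^sup>2 + 2 * y\<^sup>2 = 5" using 2 by simp
      have "[x\<^sup>2 mod 8 + 2 * (y\<^sup>2 mod 8) = x\<^sup>2 + 2 * y\<^sup>2] (mod 8)"
        by (intro cong_add cong_mult) (simp_all add: cong_def)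
      then have "(x\<^sup>2 mod 8 + 2 * (y\<^sup>2 mod 8)) mod 8 = 5" unfolding e cong_def by simp
      then show False using sq[of x] sq[of y] by auto
    qed
  qed
  obtain x y where xy: "s * x\<^sup>2 + t * y\<^sup>2 = 1" using univ[of 1] by auto
  have "s = 1 \<or> t = 1"
  proof (cases "x = 0")
    case True
    then show ?thesis using xy assms(2) by (simp add: pos_zmult_eq_1_iff)
  next
    case False
    then have "x\<^sup>2 \<ge> 1" by (simp add: int_one_le_iff_zero_less)
    then have "s \<le> s * x\<^sup>2" using assms(1) by (simp add: mult_le_cancel_left1)
    moreover have "t * y\<^sup>2 \<ge> 0" using assms(2) by simp
    ultimately show ?thesis using xy assms(1) by linarith
  qed
  then show False
  proof
    assume "s = 1"
    then show False using bound[of t] assms(2) univ by simp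
  next
    assume "t = 1"
    then show False using bound[of s] assms(1) univ by (simp add: add.commute) (metis add.commute)
  qed
qed

text \<open>Two positive integers \<open>s\<close> and \<open>t\<close> are values of the binary
  form \<open>s * x^2 + t * y^2\<close>, which is not universal.\<close>

lemma universal_criterion_card_ge_3:
  assumes "univ_criterion {0<..} T"
  shows "card T \<ge> 3"
proof (rule ccontr)
  assume "\<not> card T \<ge> 3"
  then have c: "card T \<le> 2" by simp
  have fin: "finite T" and pos: "T \<subseteq> {0<..}" using assms by (auto simp: univ_criterion_def)
  have "\<exists>s t. s > 0 \<and> t > 0 \<and> T \<subseteq> {s, t}"
  proof -
    consider "card T = 0" | "card T = 1" | "card T = 2" using c by linarith
    then show ?thesis
    proof cases
      case 1
      then show ?thesis using fin by (intro exI[of _ 1]) auto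
    next
      case 2
      then obtain s where "T = {s}" by (rule card_1_singletonE)
      then show ?thesis using pos by (intro exI[of _ s]) auto
    next
      case 3
      then obtain s t where "T = {s, t}" by (auto simp: card_2_iff)
      then show ?thesis using pos by (intro exI[of _ s] exI[of _ t]) auto
    qed
  qed
  then obtain s t where st: "s > 0" "t > 0" "T \<subseteq> {s, t}" by blast
  define d where "d = (\<lambda>i::nat. if i = 0 then s else t)"
  have q: "qform 2 (diag d) x = s * (x 0)\<^sup>2 + t * (x 1)\<^sup>2" for x
    by (simp add: qform_diag d_def numeral_eq_Suc)
  have "{s, t} \<subseteq> qvals 2 (diag d)"
  proof -
    have "(\<lambda>_. 0)(i := 1) \<in> vecs 2" if "i < 2" for i using that by (auto simp: vecs_def)
    then have "qform 2 (diag d) ((\<lambda>_. 0)(i := 1)) \<in> qvals 2 (diag d)" if "i < 2" for i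
      using that unfolding qvals_def by blast
    from this[of 0] this[of 1] show ?thesis by (simp add: q)
  qed
  moreover have "zlattice 2 (diag d)" using st by (intro zlattice_diag) (simp add: d_def)
  ultimately have "{0<..} \<subseteq> qvals 2 (diag d)" using assms st(3) unfolding univ_criterion_def by blast
  then have "\<exists>x y. s * x\<^sup>2 + t * y\<^sup>2 = a" if "a > 0" for a
    using that unfolding qvals_def q by force
  then show False using binary_diag_not_universal st(1,2) by blast
qed

text \<open>This settles the ranks up to 3. If \<open>Aset\<close> is empty, there is a single
  criterion set, one for all positive integers; otherwise \<open>Bset nub\<close> has at least three
  elements and every criterion set is nonempty.\<close>

lemma sum_criterion_cards_ge_3:
  assumes fin: "finite Aset" and T: "\<forall>eta\<in>Bset nub. univ_criterion (S_eta eta) (T eta)"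
  shows "(\<Sum>eta\<in>Bset nub. card (T eta)) \<ge> 3"
proof (cases "Aset = {}")
  case True
  then have "Bset nub = {\<lambda>_. undefined}" by (simp add: Bset_def)
  moreover have "S_eta eta = {0<..}" for eta using True by (auto simp: S_eta_def)
  ultimately show ?thesis using T universal_criterion_card_ge_3 by simp
next
  case False
  then obtain p where p: "p \<in> Aset" by blast
  have "card (T eta) \<ge> 1" if "eta \<in> Bset nub" for eta
    using criterion_card_pos[of "S_eta eta" "T eta"] T that S_eta_nonempty[OF fin that]
    by (force simp: S_eta_def)
  then have "(\<Sum>eta\<in>Bset nub. card (T eta)) \<ge> (\<Sum>eta\<in>Bset nub. 1)" by (intro sum_mono) auto
  moreover have "card (Bset nub) = (\<Prod>p\<in>Aset. card (Bp nub p))"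
    unfolding Bset_def using fin by (rule card_PiE)
  moreover have "(\<Prod>p\<in>Aset. card (Bp nub p)) \<ge> card (Bp nub p)"
  proof -
    have "(\<Prod>q\<in>Aset. card (Bp nub q)) = card (Bp nub p) * (\<Prod>q\<in>Aset - {p}. card (Bp nub q))"
      using fin p by (simp add: prod.remove)
    moreover have "card (Bp nub q) \<ge> 1" if "q \<in> Aset" for q
      using card_Bp_ge[OF Aset_prime[OF that], of nub] by simp
    then have "(\<Prod>q\<in>Aset - {p}. card (Bp nub q)) \<ge> 1" by (intro prod_ge_1) auto
    ultimately show ?thesis by (simp add: mult_le_cancel1)
  qed
  moreover have "card (Bp nub p) \<ge> 3" using card_Bp_ge Aset_prime[OF p] by blast
  ultimately show ?thesis by simp
qed

subsection \<open>The bound in rank at least 4\<close>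

text \<open>Here \<open>p^k * w\<close> stands for a dilation factor: its part \<open>w\<close>
  prime to \<open>p\<close> is a p-adic unit, so its square shifts the class by
  \<open>p^(2*k)\<close> only.\<close>

lemma unit_sq_class_scale_iff:
  assumes p: "prime p" and w: "coprime w (int p)"
  shows "unit_sq_class p (e * int p ^ (2 * k)) ((int p ^ k * w)\<^sup>2 * m) \<longleftrightarrow> unit_sq_class p e m"
proof -
  have eq: "(int p ^ k * w)\<^sup>2 * m = int p ^ (2 * k) * m * w\<^sup>2"
    by (simp add: power_mult_distrib power_mult mult_ac power_even_eq)
  have e: "e * int p ^ (2 * k) = int p ^ (2 * k) * e" by simp
  note sq = unit_sq_class_square_mult[OF w, of "int p ^ (2 * k) * m"]
  show ?thesis unfolding eq e
    using unit_sq_class_trans[OF _ sq] unit_sq_class_trans[OF _ unit_sq_class_sym[OF sq]]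
      unit_sq_class_mult unit_sq_class_cancel[OF p] by blast
qed

lemma prod_dvd_of_coprime:
  fixes c :: int
  assumes "finite A" "\<And>p. p \<in> A \<Longrightarrow> f p dvd c"
    "\<And>p q. p \<in> A \<Longrightarrow> q \<in> A \<Longrightarrow> p \<noteq> q \<Longrightarrow> coprime (f p) (f q)"
  shows "(\<Prod>p\<in>A. f p) dvd c"
  using assms
proof (induction A)
  case (insert p A)
  have "coprime (f p) (\<Prod>p\<in>A. f p)" using insert by (intro prod_coprime_right) auto
  then show ?case using insert by (simp add: divides_mult)
qed simp

section \<open>A fixed regular lattice: dilations, chosen vectors and their span\<close>

context
  fixes n G and nub :: "nat \<Rightarrow> nat" and T :: "(nat \<Rightarrow> int) \<Rightarrow> int set"
  assumes fin: "finite Aset"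
    and crit: "\<And>eta. eta \<in> Bset nub \<Longrightarrow> univ_criterion (S_eta eta) (T eta)"
    and L: "zlattice n G" and n4: "n \<ge> 4" and prim: "primitive n G" and reg: "regular n G"
begin

text \<open>For \<open>h = eta p\<close> this is the exponent \<open>k\<^sub>p\<close> of the
  outline, and \<open>dilation eta\<close> is the \<open>D\<close> there.\<close>

definition level :: "nat \<Rightarrow> int \<Rightarrow> nat" where
  "level p h = (LEAST k. loc_rep p n G (h * int p ^ (2 * k)))"

definition dilation :: "(nat \<Rightarrow> int) \<Rightarrow> int" where
  "dilation eta = (\<Prod>p\<in>Aset. int p ^ level p (eta p))"

text \<open>The first condition on \<open>p\<close> says that the minimum in \<open>level\<close> is
  attained; the second is the one under which the inner products are shown to be divisible by
  \<open>(dilation eta)^2\<close>.\<close>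

definition admissible :: "(nat \<Rightarrow> int) \<Rightarrow> bool" where
  "admissible eta \<longleftrightarrow> eta \<in> Bset nub \<and>
    (\<forall>p\<in>Aset. loc_rep p n G (eta p * int p ^ (2 * level p (eta p))) \<and>
      (level p (eta p) = 0 \<or> (int p)\<^sup>2 dvd eta p))"

lemma dilation_pos: "dilation eta > 0"
  unfolding dilation_def using Aset_prime by (intro prod_pos) (auto simp: prime_gt_0_nat)

lemma dilation_decomp:
  assumes "p \<in> Aset"
  obtains w where "coprime w (int p)" "dilation eta = int p ^ level p (eta p) * w"
proof
  let ?w = "\<Prod>q\<in>Aset - {p}. int q ^ level q (eta q)"
  show "dilation eta = int p ^ level p (eta p) * ?w"
    unfolding dilation_def using fin assms by (simp add: prod.remove)
  have "coprime (int q) (int p)" if "q \<in> Aset - {p}" for q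
    using that assms Aset_prime primes_coprime[of q p] by auto
  then show "coprime ?w (int p)" by (intro prod_coprime_left) auto
qed

lemma dilation_class_iff:
  assumes "p \<in> Aset"
  shows "unit_sq_class p (eta p * int p ^ (2 * level p (eta p))) ((dilation eta)\<^sup>2 * m)
    \<longleftrightarrow> unit_sq_class p (eta p) m"
proof -
  obtain w where w: "coprime w (int p)" "dilation eta = int p ^ level p (eta p) * w"
    using dilation_decomp[OF assms] .
  show ?thesis unfolding w(2) using unit_sq_class_scale_iff[OF Aset_prime[OF assms] w(1)] .
qed

lemma dilation_square_dvd:
  assumes "\<And>p. p \<in> Aset \<Longrightarrow> int p ^ (2 * level p (eta p)) dvd c"
  shows "(dilation eta)\<^sup>2 dvd c"
proof -
  have "(dilation eta)\<^sup>2 = (\<Prod>p\<in>Aset. int p ^ (2 * level p (eta p)))"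
    unfolding dilation_def by (simp add: prod_power_distrib[symmetric] power_even_eq)
  also have "\<dots> dvd c"
    using fin assms
  proof (rule prod_dvd_of_coprime)
    fix p q assume "p \<in> Aset" "q \<in> Aset" "p \<noteq> q"
    then have "coprime (int p) (int q)" using Aset_prime primes_coprime[of p q] by auto
    then show "coprime (int p ^ (2 * level p (eta p))) (int q ^ (2 * level q (eta q)))" by simp
  qed
  finally show ?thesis .
qed

text \<open>At primes in \<open>Aset\<close> the number lies in a represented square class, at all
  others every nonzero integer is locally represented, and regularity does the rest.\<close>

lemma scaled_class_represented:
  assumes adm: "admissible eta" and t: "t \<in> S_eta eta"
  shows "(dilation eta)\<^sup>2 * t \<in> qvals n G"
proof -
  have t0: "t > 0" using t by (simp add: S_eta_def)
  then have pos: "(dilation eta)\<^sup>2 * t > 0" using dilation_pos[of eta] by simp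
  have "loc_rep q n G ((dilation eta)\<^sup>2 * t)" if q: "prime q" for q
  proof (cases "q \<in> Aset")
    case True
    then have "unit_sq_class q (eta q) t" using t by (simp add: S_eta_def)
    then show ?thesis
      using adm True dilation_class_iff[OF True] loc_rep_cong_class unfolding admissible_def by blast
  next
    case False
    have "(dilation eta)\<^sup>2 * t \<noteq> 0" using pos by linarith
    then show ?thesis by (rule loc_rep_outside_Aset[OF L n4 prim reg q False])
  qed
  then show ?thesis using reg pos unfolding regular_def by blast
qed

definition reps :: "(nat \<Rightarrow> int) \<Rightarrow> int \<Rightarrow> nat \<Rightarrow> int" where
  "reps eta t = (SOME v. v \<in> vecs n \<and> qform n G v = (dilation eta)\<^sup>2 * t)"

lemma reps_spec:
  assumes "admissible eta" "t \<in> S_eta eta"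
  shows "reps eta t \<in> vecs n" "qform n G (reps eta t) = (dilation eta)\<^sup>2 * t"
proof -
  have "\<exists>v. v \<in> vecs n \<and> qform n G v = (dilation eta)\<^sup>2 * t"
    using scaled_class_represented[OF assms] unfolding qvals_def by (auto simp: image_iff)
  then have "reps eta t \<in> vecs n \<and> qform n G (reps eta t) = (dilation eta)\<^sup>2 * t"
    unfolding reps_def by (rule someI_ex)
  then show "reps eta t \<in> vecs n" "qform n G (reps eta t) = (dilation eta)\<^sup>2 * t" by auto
qed

text \<open>For \<open>k = level p (eta p) > 0\<close> take the value
  \<open>eta p * p^(2*(k-1))\<close>: minimality of \<open>k\<close> excludes it over the p-adic
  integers, while \<open>p^2\<close> dividing \<open>eta p\<close> makes it divisible by
  \<open>p^(2*k)\<close>.\<close>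

lemma reps_bform_dvd:
  assumes adm: "admissible eta" and t: "t \<in> S_eta eta" "t' \<in> S_eta eta"
  shows "(dilation eta)\<^sup>2 dvd bform n G (reps eta t) (reps eta t')"
proof (rule dilation_square_dvd)
  fix p assume p: "p \<in> Aset"
  let ?k = "level p (eta p)"
  show "int p ^ (2 * ?k) dvd bform n G (reps eta t) (reps eta t')"
  proof (cases "?k = 0")
    case False
    then have dvd: "(int p)\<^sup>2 dvd eta p" using adm p by (auto simp: admissible_def)
    have k: "2 * ?k = 2 + 2 * (?k - 1)" using False by simp
    have Q: "int p ^ (2 + 2 * ?k) dvd qform n G (reps eta s)" if s: "s \<in> S_eta eta" for s
    proof -
      have "unit_sq_class p (eta p * int p ^ (2 * ?k)) ((dilation eta)\<^sup>2 * s)"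
        using s p dilation_class_iff[OF p] by (simp add: S_eta_def)
      moreover have "int p ^ (2 + 2 * ?k) dvd eta p * int p ^ (2 * ?k)"
        unfolding power_add by (rule mult_dvd_mono[OF dvd dvd_refl])
      ultimately show ?thesis using reps_spec(2)[OF adm s] unit_sq_class_dvd by metis
    qed
    let ?\<tau> = "eta p * int p ^ (2 * (?k - 1))"
    have "?k - 1 < ?k" using False by simp
    then have "\<not> loc_rep p n G ?\<tau>"
      using not_less_Least[of "?k - 1" "\<lambda>k. loc_rep p n G (eta p * int p ^ (2 * k))"]
      unfolding level_def by blast
    moreover have "int p ^ (2 * ?k) dvd ?\<tau>"
      unfolding k power_add by (rule mult_dvd_mono[OF dvd dvd_refl])
    moreover have "int p ^ Suc (2 * ?k) dvd qform n G (reps eta t)"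
      using Q[OF t(1)] by (rule dvd_trans[rotated]) (simp add: le_imp_power_dvd)
    moreover have "int p ^ (2 * ?k) dvd qform n G (reps eta t')"
      using Q[OF t(2)] by (rule dvd_trans[rotated]) (simp add: le_imp_power_dvd)
    ultimately show ?thesis
      using bform_dvd_if_not_loc_rep[OF L reps_spec(1)[OF adm t(1)] reps_spec(1)[OF adm t(2)]
          Aset_prime[OF p]] by blast
  qed simp
qed

definition gens :: "(nat \<Rightarrow> int) set" where
  "gens = (\<Union>eta\<in>{eta. admissible eta}. reps eta ` T eta)"

lemma finite_Bset: "finite (Bset nub)"
  unfolding Bset_def using fin finite_Bp by (rule finite_PiE)

lemma admissible_Bset: "admissible eta \<Longrightarrow> eta \<in> Bset nub"
  by (simp add: admissible_def)

lemma T_props: "eta \<in> Bset nub \<Longrightarrow> finite (T eta)" "eta \<in> Bset nub \<Longrightarrow> T eta \<subseteq> S_eta eta"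
  using crit by (auto simp: univ_criterion_def)

lemma finite_admissible: "finite {eta. admissible eta}"
  using finite_Bset by (rule finite_subset[rotated]) (auto simp: admissible_Bset)

lemma finite_gens: "finite gens"
  unfolding gens_def using finite_admissible T_props admissible_Bset by (intro finite_UN_I) auto

lemma card_gens_le: "card gens \<le> (\<Sum>eta\<in>Bset nub. card (T eta))"
proof -
  have "card gens \<le> (\<Sum>eta\<in>{eta. admissible eta}. card (reps eta ` T eta))"
    unfolding gens_def using finite_admissible by (rule card_UN_le)
  also have "\<dots> \<le> (\<Sum>eta\<in>{eta. admissible eta}. card (T eta))"
    using T_props admissible_Bset by (intro sum_mono card_image_le) auto
  also have "\<dots> \<le> (\<Sum>eta\<in>Bset nub. card (T eta))"
    using finite_Bset admissible_Bset by (intro sum_mono2) auto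
  finally show ?thesis .
qed

lemma gens_vecs: "gens \<subseteq> vecs n"
  unfolding gens_def using reps_spec(1) T_props(2) admissible_Bset by blast

text \<open>Divisibility by \<open>(dilation eta)^2\<close> is established within a single
  \<open>eta\<close>, so the criterion is applied to the span for that \<open>eta\<close> and the
  result is carried over to the larger span.\<close>

lemma zspan_gens_represents_class:
  assumes adm: "admissible eta" and s: "s \<in> S_eta eta"
  shows "(dilation eta)\<^sup>2 * s \<in> qform n G ` zspan gens"
proof -
  let ?X = "reps eta ` T eta"
  note B = admissible_Bset[OF adm]
  note TS = T_props(2)[OF B]
  have X: "?X \<subseteq> gens" using adm unfolding gens_def by blast
  have fX: "finite ?X" using T_props(1)[OF B] by simp
  have "\<exists>x\<in>zspan ?X. qform n G x = (dilation eta)\<^sup>2 * s"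
  proof (rule sublattice_scaled_represents[OF L _ _ _ crit[OF B] _ s])
    show "sublattice n (zspan ?X)" using X gens_vecs by (intro zspan_sublattice) blast
    show "(dilation eta)\<^sup>2 > 0" using dilation_pos[of eta] by simp
    show "(dilation eta)\<^sup>2 dvd bform n G x y" if "x \<in> zspan ?X" "y \<in> zspan ?X" for x y
    proof (rule zspan_bform_dvd[OF _ that])
      fix u v assume "u \<in> ?X" "v \<in> ?X"
      then obtain t t' where "t \<in> T eta" "t' \<in> T eta" "u = reps eta t" "v = reps eta t'" by blast
      then show "(dilation eta)\<^sup>2 dvd bform n G u v" using reps_bform_dvd[OF adm] TS by blast
    qed
    show "\<exists>x\<in>zspan ?X. qform n G x = (dilation eta)\<^sup>2 * t" if t: "t \<in> T eta" for t
    proof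
      show "qform n G (reps eta t) = (dilation eta)\<^sup>2 * t" using reps_spec(2)[OF adm] t TS by blast
      show "reps eta t \<in> zspan ?X" using zspan_base[OF fX] t by blast
    qed
  qed
  then show ?thesis using zspan_mono[OF finite_gens X] by (metis imageI subsetD)
qed

text \<open>If \<open>a / p\<^sup>2\<close> is not represented over \<open>\<int>\<^sub>p\<close>, then \<open>a\<close> has the least order at which its square
  class is represented; a smaller power of \<open>p\<close> in that square class serves as component of \<open>eta\<close>.\<close>

lemma admissible_component:
  assumes p: "p \<in> Aset" and a: "a \<noteq> 0" "loc_rep p n G a"
    and min: "\<And>a'. a = (int p)\<^sup>2 * a' \<Longrightarrow> \<not> loc_rep p n G a'"
  shows "\<exists>h\<in>Bp nub p. unit_sq_class p (h * int p ^ (2 * level p h)) a \<and>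
    (level p h = 0 \<or> (int p)\<^sup>2 dvd h)"
proof -
  note pp = Aset_prime[OF p]
  define e where "e = multiplicity (int p) a"
  obtain b where b: "b \<in> unit_reps p" "unit_sq_class p (int p ^ e * b) a"
    using class_rep[OF pp a(1)] unfolding e_def by blast
  \<comment> \<open>An exponent beyond \<open>nub p + 3\<close> is lowered by an even amount to
    \<open>nub p + 3\<close> or \<open>nub p + 2\<close>; both are at least 2, which makes
    \<open>p^2\<close> divide \<open>h\<close>.\<close>
  obtain c k where ck: "e = c + 2 * k" "c \<le> nub p + 3" "k = 0 \<or> c \<ge> 2"
  proof (cases "e \<le> nub p + 3")
    case True
    then show ?thesis using that[of e 0] by simp
  next
    case False
    define r where "r = e - (nub p + 3)"
    have r: "e = nub p + 3 + r" using False by (simp add: r_def)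
    have "r = 2 * (r div 2) \<or> r = 2 * (r div 2) + 1" by presburger
    then show ?thesis
    proof
      assume "r = 2 * (r div 2)"
      then show ?thesis using that[of "nub p + 3" "r div 2"] r by simp
    next
      assume *: "r = 2 * (r div 2) + 1"
      have "nub p + 2 + 2 * (r div 2 + 1) = e" unfolding r using * by simp
      then show ?thesis using that[of "nub p + 2" "r div 2 + 1"] by simp
    qed
  qed
  define h where "h = int p ^ c * b"
  have hB: "h \<in> Bp nub p" unfolding Bp_reps h_def using ck(2) b(1) by blast
  have "int p ^ e * b = h * int p ^ (2 * k)" unfolding h_def ck(1) by (simp add: power_add mult_ac)
  then have cl: "unit_sq_class p (h * int p ^ (2 * k)) a" using b(2) by simp
  have "level p h = k"
    unfolding level_def
  proof (rule Least_equality)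
    show "loc_rep p n G (h * int p ^ (2 * k))"
      using a(2) loc_rep_cong_class unit_sq_class_sym[OF cl] by blast
    fix k' assume k': "loc_rep p n G (h * int p ^ (2 * k'))"
    show "k \<le> k'"
    proof (rule ccontr)
      assume "\<not> k \<le> k'"
      \<comment> \<open>A smaller exponent \<open>k'\<close> would, after multiplication by a
        suitable square, yield a local representation of \<open>a / p^2\<close>.\<close>
      then obtain i where i: "k = Suc (k' + i)" using less_imp_Suc_add not_le by blast
      let ?\<tau> = "(int p ^ i)\<^sup>2 * (h * int p ^ (2 * k'))"
      have \<tau>: "loc_rep p n G ?\<tau>" using k' by (rule loc_rep_square_mult)
      have "h * int p ^ (2 * k) = (int p)\<^sup>2 * ?\<tau>"
        unfolding i by (simp add: power_add power_mult power2_eq_square mult_ac power_mult_distrib)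
      then have cl': "unit_sq_class p ((int p)\<^sup>2 * ?\<tau>) a" using cl by (simp only:)
      then have "(int p)\<^sup>2 dvd a" by (rule unit_sq_class_dvd) simp
      then obtain a' where a': "a = (int p)\<^sup>2 * a'" by (elim dvdE)
      then have "unit_sq_class p ?\<tau> a'" using cl' unit_sq_class_cancel[OF pp] by blast
      then show False using min[OF a'] \<tau> loc_rep_cong_class by blast
    qed
  qed
  moreover have "k = 0 \<or> (int p)\<^sup>2 dvd h"
    using ck(3) unfolding h_def by (auto intro: dvd_mult2 le_imp_power_dvd)
  ultimately show ?thesis using hB cl by metis
qed

text \<open>Descent on \<open>a\<close>: a factor \<open>p^2\<close> is split off as long as the
  quotient is still represented over the p-adic integers; what remains lies in the scaled class of
  an admissible \<open>eta\<close>.\<close>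

lemma zspan_gens_represents:
  assumes "a > 0" "a \<in> qvals n G"
  shows "a \<in> qform n G ` zspan gens"
  using assms
proof (induction "nat a" arbitrary: a rule: less_induct)
  case less
  note a = less.prems
  show ?case
  proof (cases "\<exists>p\<in>Aset. \<exists>a'. a = (int p)\<^sup>2 * a' \<and> loc_rep p n G a'")
    case True
    then obtain p a' where p: "p \<in> Aset" and a': "a = (int p)\<^sup>2 * a'" "loc_rep p n G a'" by blast
    have p1: "(int p)\<^sup>2 > 1" using prime_gt_1_nat[OF Aset_prime[OF p]] by simp
    then have pos: "a' > 0" using a(1) a'(1) by (metis zero_less_mult_pos zero_less_one less_trans)
    then have lt: "a' < a" using p1 a'(1) by simp
    \<comment> \<open>At primes other than \<open>p\<close> the factor \<open>p^2\<close> is the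
      square of a unit, so \<open>a'\<close> inherits representability from
      \<open>a\<close>.\<close>
    have "loc_rep q n G a'" if q: "prime q" for q
    proof (cases "q = p")
      case False
      then have "coprime (int p) (int q)" using primes_coprime[of p q] Aset_prime[OF p] q by simp
      then have "unit_sq_class q a a'"
        using unit_sq_class_sym[OF unit_sq_class_square_mult[of "int p" q a']] a'(1)
        by (simp add: mult.commute)
      then show ?thesis using loc_rep_qvals[OF a(2)] loc_rep_cong_class by blast
    qed (use a' in simp)
    then have "a' \<in> qvals n G" using reg pos unfolding regular_def by blast
    then obtain x where x: "x \<in> zspan gens" "a' = qform n G x" using less.hyps[of a'] lt pos by auto
    have "(\<lambda>i. int p * x i) \<in> zspan gens"
      using zspan_sublattice[OF gens_vecs] x(1) by (simp add: sublattice_def)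
    moreover have "qform n G (\<lambda>i. int p * x i) = a" using x(2) a'(1) by (simp add: qform_scale)
    ultimately show ?thesis by blast
  next
    case False
    have "\<exists>h\<in>Bp nub p. unit_sq_class p (h * int p ^ (2 * level p h)) a \<and>
        (level p h = 0 \<or> (int p)\<^sup>2 dvd h)" if "p \<in> Aset" for p
      using admissible_component[OF that _ loc_rep_qvals[OF a(2)]] a(1) False that by blast
    then obtain h where h: "\<And>p. p \<in> Aset \<Longrightarrow> h p \<in> Bp nub p"
      "\<And>p. p \<in> Aset \<Longrightarrow> unit_sq_class p (h p * int p ^ (2 * level p (h p))) a"
      "\<And>p. p \<in> Aset \<Longrightarrow> level p (h p) = 0 \<or> (int p)\<^sup>2 dvd h p"
      by metis
    define eta where "eta = restrict h Aset"
    have eta: "eta p = h p" if "p \<in> Aset" for p using that by (simp add: eta_def)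
    have cl: "unit_sq_class p (eta p * int p ^ (2 * level p (eta p))) a" if "p \<in> Aset" for p
      using h(2) that eta by simp
    have adm: "admissible eta"
      unfolding admissible_def
    proof (intro conjI ballI)
      show "eta \<in> Bset nub" unfolding Bset_def eta_def using h(1) by auto
      fix p assume p: "p \<in> Aset"
      show "loc_rep p n G (eta p * int p ^ (2 * level p (eta p)))"
        using loc_rep_qvals[OF a(2)] loc_rep_cong_class unit_sq_class_sym[OF cl[OF p]]
        by blast
      show "level p (eta p) = 0 \<or> (int p)\<^sup>2 dvd eta p" using h(3)[OF p] eta[OF p] by simp
    qed
    have "(dilation eta)\<^sup>2 dvd a" using cl unit_sq_class_dvd by (intro dilation_square_dvd) (metis dvd_triv_right)
    then obtain a' where a': "a = (dilation eta)\<^sup>2 * a'" by (elim dvdE)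
    have "(dilation eta)\<^sup>2 > 0" using dilation_pos[of eta] by simp
    then have "a' > 0" using a(1) a' by (metis zero_less_mult_pos)
    then have "a' \<in> S_eta eta" unfolding S_eta_def using cl dilation_class_iff a' by auto
    then show ?thesis using zspan_gens_represents_class[OF adm] a' by blast
  qed
qed

lemma qform_zspan_gens: "qform n G ` zspan gens = qvals n G"
proof
  have sub: "zspan gens \<subseteq> vecs n" "(\<lambda>_. 0) \<in> zspan gens"
    using zspan_sublattice[OF gens_vecs] by (auto simp: sublattice_def)
  then show "qform n G ` zspan gens \<subseteq> qvals n G" unfolding qvals_def by blast
  show "qvals n G \<subseteq> qform n G ` zspan gens"
  proof
    fix a assume a: "a \<in> qvals n G"
    then have "a \<ge> 0" using qform_nonneg(1)[OF L] unfolding qvals_def by blast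
    moreover have "qform n G (\<lambda>_. 0) = 0" by (simp add: qform_def bform_def)
    ultimately show "a \<in> qform n G ` zspan gens"
      using zspan_gens_represents[OF _ a] sub(2) by (cases "a = 0") (auto intro: rev_image_eqI)
  qed
qed

lemma new_regular_rank_le:
  assumes "new_regular n G"
  shows "n \<le> (\<Sum>eta\<in>Bset nub. card (T eta))"
proof -
  have "zspan gens = vecs n"
    using assms qform_zspan_gens zspan_sublattice[OF gens_vecs] unfolding new_regular_def by blast
  then have "n \<le> card gens" using rank_le_card_generators[OF finite_gens] by simp
  then show ?thesis using card_gens_le by linarith
qed

end

subsection \<open>Imprimitive lattices\<close>

text \<open>The gcd of all inner products serves as \<open>d\<close>; it divides the entries of
  \<open>G\<close>, which are inner products of unit vectors.\<close>

lemma primitive_scaling: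
  assumes L: "zlattice n G" and n: "n > 0"
  obtains d H where "d > 0" "zlattice n H" "primitive n H" "\<And>x y. bform n G x y = d * bform n H x y"
proof -
  let ?S = "{bform n G x y |x y. x \<in> vecs n \<and> y \<in> vecs n}"
  define d where "d = Gcd ?S"
  define e :: "nat \<Rightarrow> nat \<Rightarrow> int" where "e i = (\<lambda>l. if l = i then 1 else 0)" for i
  have ev: "e i \<in> vecs n" if "i < n" for i using that by (auto simp: e_def vecs_def)
  have eG: "bform n G (e i) (e j) = G i j" if "i < n" "j < n" for i j
  proof -
    have "bform n G (e i) (e j) = (\<Sum>k<n. \<Sum>l<n. if l = j then (if k = i then G k l else 0) else 0)"
      unfolding bform_def e_def by (intro sum.cong) auto
    also have "\<dots> = G i j" using that by simp
    finally show ?thesis .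
  qed
  have dvd: "d dvd bform n G x y" if "x \<in> vecs n" "y \<in> vecs n" for x y
    unfolding d_def using that by (intro Gcd_dvd) blast
  define H where "H i j = G i j div d" for i j
  have dH: "d * H i j = G i j" if "i < n" "j < n" for i j
    using dvd[OF ev ev, OF that] eG[OF that] by (simp add: H_def)
  have B: "bform n G x y = d * bform n H x y" for x y
    unfolding bform_def sum_distrib_left
    by (intro sum.cong refl) (simp add: dH[symmetric])
  \<comment> \<open>Positive rank provides a nonzero value, so the gcd is not 0.\<close>
  have "e 0 \<noteq> (\<lambda>_. 0)" by (auto simp: e_def fun_eq_iff)
  then have "qform n G (e 0) > 0" using L ev[OF n] by (simp add: zlattice_def)
  then have "d \<noteq> 0" using B[of "e 0" "e 0"] by (auto simp: qform_def)
  moreover have "d \<ge> 0" unfolding d_def by simp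
  ultimately have d: "d > 0" by simp
  have "zlattice n H"
    unfolding zlattice_def
  proof (intro conjI allI impI ballI)
    show "H i j = H j i" if "i < n" "j < n" for i j using L that by (simp add: H_def zlattice_def)
    fix x assume "x \<in> vecs n" "x \<noteq> (\<lambda>_. 0)"
    then have "d * qform n H x > 0" using L B by (simp add: zlattice_def qform_def)
    then show "qform n H x > 0" using d by (simp add: zero_less_mult_iff)
  qed
  moreover have "primitive n H"
    unfolding primitive_def
  proof (intro allI impI)
    fix c assume c: "\<forall>x\<in>vecs n. \<forall>y\<in>vecs n. c dvd bform n H x y"
    have "d * c dvd Gcd ?S" using c B by (intro Gcd_greatest) auto
    then have "d * c dvd d" by (simp add: d_def)
    then show "is_unit c" using d by (simp add: mult.commute dvd_times_left_cancel_iff)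
  qed
  ultimately show ?thesis using that d B by blast
qed

text \<open>All sets of values, those of sublattices included, are multiplied by \<open>d\<close>,
  and multiplication by \<open>d\<close> is injective.\<close>

lemma new_regular_unscale:
  assumes d: "d > 0" and B: "\<And>x y. bform n G x y = d * bform n H x y"
    and new: "new_regular n G"
  shows "new_regular n H"
proof -
  have Q: "qform n G x = d * qform n H x" for x using B by (simp add: qform_def)
  have img: "qform n G ` M = (*) d ` (qform n H ` M)" for M
    unfolding image_image Q ..
  have inj: "inj ((*) d)" using d by (simp add: inj_def)
  have "regular n H"
    unfolding regular_def
  proof (intro allI impI)
    fix a :: int assume a: "a > 0" and loc: "\<forall>p. prime p \<longrightarrow> loc_rep p n H a"
    have "loc_rep p n G (d * a)" if p: "prime p" for p
      unfolding loc_rep_def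
    proof
      fix k
      obtain x where x: "x \<in> vecs n" "[qform n H x = a] (mod int p ^ k)"
        using loc p unfolding loc_rep_def by blast
      show "\<exists>x\<in>vecs n. [qform n G x = d * a] (mod int p ^ k)"
        unfolding Q using x(1) cong_scalar_left[OF x(2), of d] by (intro bexI[of _ x])
    qed
    moreover have "d * a > 0" using a d by simp
    ultimately have "d * a \<in> qvals n G" using new unfolding new_regular_def regular_def by blast
    then show "a \<in> qvals n H" unfolding qvals_def img using inj by (simp add: inj_image_mem_iff)
  qed
  moreover have "qform n G ` M = qvals n G" if "qform n H ` M = qvals n H" for M
    using that unfolding qvals_def img by simp
  ultimately show ?thesis using new unfolding new_regular_def by blast
qed

theorem theorem3p1:
  fixes nub :: "nat \<Rightarrow> nat"
    and T :: "(nat \<Rightarrow> int) \<Rightarrow> int set"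
  assumes "finite Aset"
    and "\<forall>p\<in>Aset. nub p > 0 \<and>
           (\<forall>n G. zlattice n G \<and> n \<ge> 4 \<and> primitive n G \<and> regular n G \<longrightarrow> nu' p n G \<le> nub p)"
    and "\<forall>eta\<in>Bset nub. univ_criterion (S_eta eta) (T eta)"
  shows "(\<forall>n G. zlattice n G \<and> primitive n G \<and> new_regular n G \<longrightarrow>
            n \<le> (\<Sum>eta\<in>Bset nub. card (T eta)))
         \<and> (\<exists>C::nat. \<forall>n G. zlattice n G \<and> new_regular n G \<longrightarrow> n \<le> C)"
proof -
  let ?C = "\<Sum>eta\<in>Bset nub. card (T eta)"
  have prim: "n \<le> ?C" if "zlattice n G" "primitive n G" "new_regular n G" for n G
  proof (cases "n \<ge> 4")
    case True
    have "regular n G" using that(3) by (simp add: new_regular_def)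
    then show ?thesis
      using new_regular_rank_le[OF assms(1) _ that(1) True that(2) _ that(3)] assms(3) by blast
  next
    case False
    \<comment> \<open>Here the rank is at most 3, which the sum always reaches.\<close>
    then show ?thesis using sum_criterion_cards_ge_3[OF assms(1,3)] by linarith
  qed
  have "n \<le> ?C" if L: "zlattice n G" and new: "new_regular n G" for n G
  \<comment> \<open>In rank 0 all inner products vanish and no primitive rescaling exists, but the
    bound is trivial; in positive rank, division by the gcd of the inner products leads to the
    primitive case.\<close>
  proof (cases "n = 0")
    case False
    then obtain d H where "d > 0" "zlattice n H" "primitive n H"
        "\<And>x y. bform n G x y = d * bform n H x y"
      using primitive_scaling[OF L] by blast
    then show ?thesis using prim new_regular_unscale[OF _ _ new] by blast
  qed simp
  then show ?thesis using prim by blast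
qed

end
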